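(* For the optimal policy $\boldsymbol{F}^*=\{{f^*}_{q,a}^s\}$ there exist $(A+1)\times(S+1)$ thresholds $q_{\boldsymbol{F}^*}(s,a)$, where $0\le q_{\boldsymbol{F}^*}(0,a)\le q_{\boldsymbol{F}^*}(1,a)\le\cdots\le q_{\boldsymbol{F}^*}(S,a)\le Q$ for each arrival rate $a=0,1,\dots,A$. With all the thresholds $q_{\boldsymbol{F}^*}(s,a)$ given, the optimal policy satisfies $$\begin{cases} {f^*}_{q,a}^s=1, & q_{\boldsymbol{F}^*}(s-1,a)<q\le q_{\boldsymbol{F}^*}(s,a),\ a\ne a^*\text{ or }s\ne s^*,\\ {f^*}_{q,a}^s=1, & q_{\boldsymbol{F}^*}(s-1,a)<q<q_{\boldsymbol{F}^*}(s,a),\ a=a^*\text{ and }s=s^*,\\ {f^*}_{q,a}^s+{f^*}_{q,a}^{s-1}=1, & q=q_{\boldsymbol{F}^*}(s,a),\ a=a^*\text{ and }s=s^*,\\ {f^*}_{q,a}^s=0, & \text{otherwise,} \end{cases}$$ where the specific transmission rate $s^*$ and arrival rate $a^*$ are given by the optimal policy $\boldsymbol{F}^*$, and $q_{\boldsymbol{F}^*}(-1,a)=-1$ for each $0\le a\le A$.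
   Context: Setting (single queue, adaptive transmitter, AWGN channel). $A,S,Q$ are positive integers with $S\ge A$ and $Q\ge A$. Arrivals $a[n]\in\{0,\dots,A\}$ form a stationary and ergodic Markov chain with transition probabilities $\gamma_{a,a'}$; $\alpha=\sum_a a\phi_a$ is the mean number of arrivals per slot, where $\phi$ is the stationary distribution. The queue length $q[n]\in\{0,\dots,Q\}$ evolves by $q[n+1]=q[n]-s[n]+a[n+1]$, where the transmission rate $s[n]\in\{0,\dots,S\}$ must lie in $\mathcal{S}(q)=\{s:\max\{q-Q+A,0\}\le s\le\min\{q,S\}\}$ with $q=q[n]$. $P(s)$, $0\le s\le S$, is the power consumed when transmitting $s$ packets; $P(0)=0$, and $P$ is monotonically increasing and convex in $s$. A policy is a family $\boldsymbol{F}=\{f_{q,a}^s\}$ with $f_{q,a}^s\ge0$, $\sum_s f_{q,a}^s=1$, $f_{q,a}^s=0$ for $s\notin\mathcal{S}(q)$; $f_{q,a}^s$ is the probability of $s[n]=s$ given $q[n]=q,a[n]=a$. Under $\boldsymbol{F}$, $(q[n],a[n])$ is a Markov chain; $\boldsymbol{F}$ obtains $(P,D)$ if this chain has a stationary distribution $\pi$ with $P=\sum_{q,a,s}P(s)\pi(q,a)f_{q,a}^s$ and $D=\frac1\alpha\sum_{q,a}q\,\pi(q,a)$. $\mathcal{R}$ is the set of all pairs $(P,D)$ obtained by policies, and the optimal delay-power tradeoff curve is $$\mathcal{L}=\{(P^*,D^* )\in\mathcal{R}:\ \text{for all }(\bar P,\bar D)\in\mathcal{R},\ \text{either }P^*\le\bar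 P\text{ or }D^*\le\bar D\}.$$ The optimal policy $\boldsymbol{F}^*$ is the one for a given power-delay pair on $\mathcal{L}$, i.e. the policy obtaining that pair; the statement is made for each pair on $\mathcal{L}$.
   Formalization: Third row corrected to f^s+f^{s+1}=1 (printed s-1 fails for A=S=2, Q=3, P=(0,1,3), uniform arrivals); "otherwise" does not zero the rate s*+1 at q(s*,a* ), a*; "the optimal policy" means some policy obtaining the given pair, since not all such policies have this form. *)

theory Defs
  imports Complex_Main
begin

definition stochastic_on :: "'x set \<Rightarrow> ('x \<Rightarrow> 'x \<Rightarrow> real) \<Rightarrow> bool" where
  "stochastic_on X K \<longleftrightarrow> (\<forall>x\<in>X. (\<forall>y\<in>X. 0 \<le> K x y) \<and> (\<Sum>y\<in>X. K x y) = 1)"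

definition stationary_dist :: "'x set \<Rightarrow> ('x \<Rightarrow> 'x \<Rightarrow> real) \<Rightarrow> ('x \<Rightarrow> real) \<Rightarrow> bool" where
  "stationary_dist X K \<pi> \<longleftrightarrow>
     (\<forall>x\<in>X. 0 \<le> \<pi> x) \<and> (\<Sum>x\<in>X. \<pi> x) = 1 \<and> (\<forall>y\<in>X. \<pi> y = (\<Sum>x\<in>X. \<pi> x * K x y))"

text \<open>On a finite state space a stationary chain of full support is ergodic (as a stationary
  process) if and only if its transition graph is strongly connected; aperiodicity is not
  required.\<close>

definition ergodic_chain :: "'x set \<Rightarrow> ('x \<Rightarrow> 'x \<Rightarrow> real) \<Rightarrow> bool" where
  "ergodic_chain X K \<longleftrightarrow> stochastic_on X K \<and>
     (\<forall>x\<in>X. \<forall>y\<in>X. (x, y) \<in> {(u, v). u \<in> X \<and> v \<in> X \<and> 0 < K u v}\<^sup>*)"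

definition mean_arrivals :: "nat \<Rightarrow> (nat \<Rightarrow> real) \<Rightarrow> real" where
  "mean_arrivals A \<phi> = (\<Sum>a\<le>A. real a * \<phi> a)"

definition convex_power :: "nat \<Rightarrow> (nat \<Rightarrow> real) \<Rightarrow> bool" where
  "convex_power S Pw \<longleftrightarrow> (\<forall>s. s + 2 \<le> S \<longrightarrow> Pw (s + 1) - Pw s \<le> Pw (s + 2) - Pw (s + 1))"

text \<open>Truncated subtraction on \<^typ>\<open>nat\<close> supplies the maximum with 0 in the lower bound.\<close>

definition rates :: "nat \<Rightarrow> nat \<Rightarrow> nat \<Rightarrow> nat \<Rightarrow> nat set" where
  "rates A S Q q = {(q + A) - Q .. min q S}"

text \<open>\<open>F q a s\<close> is the probability of transmitting \<open>s\<close> packets in state \<open>(q, a)\<close>.\<close>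

definition policy :: "nat \<Rightarrow> nat \<Rightarrow> nat \<Rightarrow> (nat \<Rightarrow> nat \<Rightarrow> nat \<Rightarrow> real) \<Rightarrow> bool" where
  "policy A S Q F \<longleftrightarrow> (\<forall>q\<le>Q. \<forall>a\<le>A.
     (\<forall>s. 0 \<le> F q a s) \<and> (\<Sum>s\<le>S. F q a s) = 1 \<and> (\<forall>s. s \<notin> rates A S Q q \<longrightarrow> F q a s = 0))"

definition states :: "nat \<Rightarrow> nat \<Rightarrow> (nat \<times> nat) set" where
  "states A Q = {..Q} \<times> {..A}"

text \<open>The condition \<open>q' + s = q + a'\<close> is the queue recursion \<open>q' = q - s + a'\<close> without truncated
  subtraction.\<close>

definition joint_kernel ::
  "nat \<Rightarrow> (nat \<Rightarrow> nat \<Rightarrow> real) \<Rightarrow> (nat \<Rightarrow> nat \<Rightarrow> nat \<Rightarrow> real) \<Rightarrow> nat \<times> nat \<Rightarrow> nat \<times> nat \<Rightarrow> real" where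
  "joint_kernel S \<gamma> F = (\<lambda>(q, a) (q', a').
     \<Sum>s\<le>S. if q' + s = q + a' then F q a s * \<gamma> a a' else 0)"

definition avg_power ::
  "nat \<Rightarrow> nat \<Rightarrow> nat \<Rightarrow> (nat \<Rightarrow> real) \<Rightarrow> (nat \<Rightarrow> nat \<Rightarrow> nat \<Rightarrow> real) \<Rightarrow> (nat \<times> nat \<Rightarrow> real) \<Rightarrow> real" where
  "avg_power A S Q Pw F \<pi> = (\<Sum>(q, a)\<in>states A Q. \<Sum>s\<le>S. Pw s * \<pi> (q, a) * F q a s)"

definition avg_delay :: "nat \<Rightarrow> nat \<Rightarrow> (nat \<Rightarrow> real) \<Rightarrow> (nat \<times> nat \<Rightarrow> real) \<Rightarrow> real" where
  "avg_delay A Q \<phi> \<pi> = (1 / mean_arrivals A \<phi>) * (\<Sum>(q, a)\<in>states A Q. real q * \<pi> (q, a))"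

text \<open>The stationary distribution need not be unique, so one policy may obtain several pairs.\<close>

definition obtains_pair ::
  "nat \<Rightarrow> nat \<Rightarrow> nat \<Rightarrow> (nat \<Rightarrow> nat \<Rightarrow> real) \<Rightarrow> (nat \<Rightarrow> real) \<Rightarrow> (nat \<Rightarrow> real)
   \<Rightarrow> (nat \<Rightarrow> nat \<Rightarrow> nat \<Rightarrow> real) \<Rightarrow> real \<times> real \<Rightarrow> bool" where
  "obtains_pair A S Q \<gamma> \<phi> Pw F pd \<longleftrightarrow>
     (\<exists>\<pi>. stationary_dist (states A Q) (joint_kernel S \<gamma> F) \<pi> \<and>
          pd = (avg_power A S Q Pw F \<pi>, avg_delay A Q \<phi> \<pi>))"

definition achievable ::
  "nat \<Rightarrow> nat \<Rightarrow> nat \<Rightarrow> (nat \<Rightarrow> nat \<Rightarrow> real) \<Rightarrow> (nat \<Rightarrow> real) \<Rightarrow> (nat \<Rightarrow> real) \<Rightarrow> (real \<times> real) set" where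
  "achievable A S Q \<gamma> \<phi> Pw = {pd. \<exists>F. policy A S Q F \<and> obtains_pair A S Q \<gamma> \<phi> Pw F pd}"

definition tradeoff_curve ::
  "nat \<Rightarrow> nat \<Rightarrow> nat \<Rightarrow> (nat \<Rightarrow> nat \<Rightarrow> real) \<Rightarrow> (nat \<Rightarrow> real) \<Rightarrow> (nat \<Rightarrow> real) \<Rightarrow> (real \<times> real) set" where
  "tradeoff_curve A S Q \<gamma> \<phi> Pw = {(Pst, Dst). (Pst, Dst) \<in> achievable A S Q \<gamma> \<phi> Pw \<and>
     (\<forall>(Pb, Db)\<in>achievable A S Q \<gamma> \<phi> Pw. Pst \<le> Pb \<or> Dst \<le> Db)}"

text \<open>Thresholds \<open>thr s a\<close> are integer-indexed so that \<open>thr (-1) a = -1\<close> can be stated.\<close>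

definition thresholds :: "nat \<Rightarrow> nat \<Rightarrow> nat \<Rightarrow> (int \<Rightarrow> nat \<Rightarrow> int) \<Rightarrow> bool" where
  "thresholds A S Q thr \<longleftrightarrow> (\<forall>a\<le>A. thr (-1) a = -1 \<and> 0 \<le> thr 0 a \<and>
     (\<forall>s<S. thr (int s) a \<le> thr (int s + 1) a) \<and> thr (int S) a \<le> int Q)"

text \<open>Randomisation takes place only at the queue length \<open>thr sst ast\<close> with arrival rate \<open>ast\<close>, and
  is between the rate \<open>sst\<close> used just below this threshold and the rate \<open>sst + 1\<close>. (With \<open>sst - 1\<close> in
  place of \<open>sst + 1\<close> the rate would not be monotone in the queue length, and optimal pairs exist that
  no policy of that form obtains.) The last clause is the case ``otherwise''; it exempts the entry for
  \<open>sst + 1\<close> at this one state, which the third clause already governs.\<close>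

definition threshold_policy ::
  "nat \<Rightarrow> nat \<Rightarrow> nat \<Rightarrow> (int \<Rightarrow> nat \<Rightarrow> int) \<Rightarrow> nat \<Rightarrow> nat \<Rightarrow> (nat \<Rightarrow> nat \<Rightarrow> nat \<Rightarrow> real) \<Rightarrow> bool" where
  "threshold_policy A S Q thr sst ast F \<longleftrightarrow> (\<forall>q\<le>Q. \<forall>a\<le>A. \<forall>s\<le>S.
     (thr (int s - 1) a < int q \<and> int q \<le> thr (int s) a \<and> (a \<noteq> ast \<or> s \<noteq> sst)
        \<longrightarrow> F q a s = 1) \<and>
     (thr (int s - 1) a < int q \<and> int q < thr (int s) a \<and> a = ast \<and> s = sst
        \<longrightarrow> F q a s = 1) \<and>
     (int q = thr (int s) a \<and> a = ast \<and> s = sst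
        \<longrightarrow> F q a s + F q a (s + 1) = 1) \<and>
     (\<not> (thr (int s - 1) a < int q \<and> int q \<le> thr (int s) a \<and> (a \<noteq> ast \<or> s \<noteq> sst)) \<and>
      \<not> (thr (int s - 1) a < int q \<and> int q < thr (int s) a \<and> a = ast \<and> s = sst) \<and>
      \<not> (int q = thr (int sst) a \<and> a = ast \<and> (s = sst \<or> s = sst + 1))
        \<longrightarrow> F q a s = 0))"

end

theory Submission
  imports Defs "HOL-Analysis.Analysis"
begin

text \<open>The achievable set is convex, so a pair on the tradeoff curve minimises some
  \<open>k P + l D\<close> over it. For this linear cost the average-cost optimality equation has a solution
  \<open>h\<close> that is convex and nondecreasing in the queue length (value iteration preserves convexity;
  then let the discount vanish). Hence the sets of optimal rates are intervals whose end points grow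
  by 0 or 1 when the queue length grows by 1.

  Let \<open>k > 0\<close>. Among the optimal policies, always transmitting at the largest (smallest) optimal rate
  gives the shortest (longest) queue. Among the monotone pure policies with optimal rates that can have
  at least the required mean queue length, take one with the largest sum of rates. If it is not the
  fastest one, raise its rate by 1, for some \<open>a\<close>, at the last queue length where this is possible:
  now the mean queue length is at most the required one. Mixing the two occupation measures randomises
  in a single state and yields the required pair. If \<open>k = 0\<close>, transmitting as much as possible is the
  only optimal behaviour.\<close>

subsection \<open>Exchange convexity\<close>

text \<open>The chain of one policy may have several recurrent classes, so the mean queue length is
  not a function of the policy. All comparisons therefore concern a policy together with a
  stationary distribution, and what is mixed are occupation measures
  \<open>\<pi> (q, a) * F q a s\<close>, in which power and queue length are linear. For the same
  reason "can have at least the required mean" is existential: by maximality no stationary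
  distribution of the raised policy reaches the required mean, so any of them serves. The growth by
  0 or 1 has two uses. Rates that do not fall define thresholds; rates that rise by at most 1 leave
  residual queues that do not fall, which the comparison of queues requires. The intermediate
  policies only have to keep the first property. The curve is weakly Pareto optimal, so
  \<open>k = 0\<close> and \<open>l = 0\<close> both occur. For \<open>l = 0\<close> the cost is
  power alone, and matching the mean queue length fixes the delay. For \<open>k = 0\<close> the line
  says nothing about power, so the behaviour on the support of \<open>\<pi>\<close> must be
  kept.\<close>

definition exchange_convex :: "nat \<Rightarrow> (nat \<Rightarrow> real) \<Rightarrow> bool" where
  "exchange_convex N f \<longleftrightarrow> (\<forall>i j. i < j \<and> j \<le> N \<longrightarrow> f (Suc i) + f (j - 1) \<le> f i + f j)"

lemma exchange_convexD:
  "exchange_convex N f \<Longrightarrow> i < j \<Longrightarrow> j \<le> N \<Longrightarrow> f (Suc i) + f (j - 1) \<le> f i + f j"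
  by (auto simp: exchange_convex_def)

text \<open>Nondecreasing increments bound the increment at \<open>i\<close> by the one at
  \<open>j - 1\<close>. The exchange form moves one unit from \<open>j\<close> to \<open>i\<close>,
  which is how later arguments trade a packet between two rates or two residual queues.\<close>

lemma convex_power_imp_exchange_convex:
  assumes "convex_power N f"
  shows "exchange_convex N f"
  unfolding exchange_convex_def
proof (intro allI impI)
  fix i j :: nat
  assume ij: "i < j \<and> j \<le> N"
  have "Suc k \<le> N \<longrightarrow> f (Suc i) - f i \<le> f (Suc k) - f k" if "i \<le> k" for k
    using that
  proof (induction k rule: dec_induct)
    case (step k)
    then show ?case
      using assms by (force simp: convex_power_def)
  qed simp
  from this[of "j - 1"] ij show "f (Suc i) + f (j - 1) \<le> f i + f j"
    by (cases j) auto
qed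

lemma exchange_convex_scale:
  "exchange_convex N f \<Longrightarrow> 0 \<le> c \<Longrightarrow> exchange_convex N (\<lambda>i. c * f i)"
  unfolding exchange_convex_def by (auto simp flip: distrib_left intro!: mult_left_mono)

subsection \<open>Stationary distributions and supporting lines\<close>

text \<open>Bolzano-Weierstrass one coordinate at a time: each new point of \<open>X\<close> costs a
  further subsequence, along which the earlier limits persist.\<close>

lemma finite_pointwise_convergent_subsequence:
  fixes f :: "nat \<Rightarrow> 'x \<Rightarrow> real"
  assumes "finite X" and "\<And>k x. x \<in> X \<Longrightarrow> \<bar>f k x\<bar> \<le> B"
  shows "\<exists>l r. strict_mono r \<and> (\<forall>x\<in>X. (\<lambda>k. f (r k) x) \<longlonglongrightarrow> l x)"
  using assms
proof (induction X rule: finite_induct)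
  case empty
  have "strict_mono (id :: nat \<Rightarrow> nat)" by (simp add: strict_mono_def)
  then show ?case by blast
next
  case (insert y X)
  then obtain l r where r: "strict_mono r" and l: "\<And>x. x \<in> X \<Longrightarrow> (\<lambda>k. f (r k) x) \<longlonglongrightarrow> l x"
    by (metis insertCI)
  have "bounded (range (\<lambda>k. f (r k) y))"
    using insert.prems[of y] by (auto simp: bounded_iff)
  then obtain c s where s: "strict_mono (s :: nat \<Rightarrow> nat)" and c: "((\<lambda>k. f (r k) y) \<circ> s) \<longlonglongrightarrow> c"
    using bounded_imp_convergent_subsequence by blast
  have "(\<lambda>k. f ((r \<circ> s) k) x) \<longlonglongrightarrow> (l(y := c)) x" if "x \<in> insert y X" for x
  proof (cases "x = y")
    case True
    then show ?thesis using c by (simp add: comp_def)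
  next
    case False
    then show ?thesis
      using that LIMSEQ_subseq_LIMSEQ[OF l s] by (auto simp: comp_def)
  qed
  then show ?case
    using strict_mono_o[OF r s] by blast
qed

text \<open>Cesaro averages of the chain started from \<open>\<pi>\<close>; bounds on test functions survive the limit.\<close>

lemma stationary_dist_exists:
  fixes K :: "'x \<Rightarrow> 'x \<Rightarrow> real"
  assumes fin: "finite X" and K: "stochastic_on X K"
    and \<pi>0: "\<And>x. x \<in> X \<Longrightarrow> 0 \<le> \<pi> x" and \<pi>1: "(\<Sum>x\<in>X. \<pi> x) = 1"
    and inv: "\<And>f. f \<in> \<F> \<Longrightarrow> (\<lambda>x. \<Sum>y\<in>X. K x y * f y) \<in> \<F>"
    and dec: "\<And>f. f \<in> \<F> \<Longrightarrow> (\<Sum>x\<in>X. \<pi> x * (\<Sum>y\<in>X. K x y * f y)) \<le> (\<Sum>x\<in>X. \<pi> x * f x)"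
  shows "\<exists>\<rho>. stationary_dist X K \<rho> \<and> (\<forall>f\<in>\<F>. (\<Sum>x\<in>X. \<rho> x * f x) \<le> (\<Sum>x\<in>X. \<pi> x * f x))"
proof -
  define P where "P n = ((\<lambda>m y. \<Sum>x\<in>X. m x * K x y) ^^ n) \<pi>" for n
  have P_0: "P 0 = \<pi>" and P_Suc: "P (Suc n) = (\<lambda>y. \<Sum>x\<in>X. P n x * K x y)" for n
    by (simp_all add: P_def)
  have swap: "(\<Sum>y\<in>X. (\<Sum>x\<in>X. m x * K x y) * f y) = (\<Sum>x\<in>X. m x * (\<Sum>y\<in>X. K x y * f y))" for m f
    unfolding sum_distrib_left sum_distrib_right by (subst sum.swap) (simp add: mult.assoc)
  have P_nonneg: "0 \<le> P n x" if "x \<in> X" for n x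
    using that K by (induction n arbitrary: x) (auto simp: P_0 P_Suc \<pi>0 stochastic_on_def intro!: sum_nonneg)
  have P_sum: "(\<Sum>x\<in>X. P n x) = 1" for n
  proof (induction n)
    case (Suc n)
    have "(\<Sum>x\<in>X. P (Suc n) x) = (\<Sum>x\<in>X. P n x * (\<Sum>y\<in>X. K x y))"
      using swap[of "P n" "\<lambda>_. 1"] by (simp add: P_Suc)
    also have "\<dots> = (\<Sum>x\<in>X. P n x)"
      using K by (intro sum.cong) (auto simp: stochastic_on_def)
    finally show ?case using Suc by simp
  qed (simp add: P_0 \<pi>1)
  \<comment> \<open>One application of \<open>K\<close> moves from the measure to the test function.
    Closure of \<open>\<F>\<close> under \<open>K\<close> is what lets the induction hypothesis
    apply to the new function.\<close>
  have P_dec: "(\<Sum>x\<in>X. P n x * f x) \<le> (\<Sum>x\<in>X. \<pi> x * f x)" if "f \<in> \<F>" for n f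
    using that
  proof (induction n arbitrary: f)
    case (Suc n)
    have "(\<Sum>x\<in>X. P (Suc n) x * f x) = (\<Sum>x\<in>X. P n x * (\<Sum>y\<in>X. K x y * f y))"
      by (simp add: P_Suc swap)
    also have "\<dots> \<le> (\<Sum>x\<in>X. \<pi> x * (\<Sum>y\<in>X. K x y * f y))"
      by (rule Suc.IH[OF inv[OF Suc.prems]])
    also have "\<dots> \<le> (\<Sum>x\<in>X. \<pi> x * f x)"
      by (rule dec[OF Suc.prems])
    finally show ?case .
  qed (simp add: P_0)
  have P_le1: "P n x \<le> 1" if "x \<in> X" for n x
    using member_le_sum[of x X "P n"] that P_nonneg P_sum[of n] fin by auto
  define avg where "avg N x = (\<Sum>n<Suc N. P n x) / real (Suc N)" for N x
  have avg_nonneg: "0 \<le> avg N x" if "x \<in> X" for N x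
    unfolding avg_def using that P_nonneg by (intro divide_nonneg_nonneg sum_nonneg) auto
  have avg_sum: "(\<Sum>x\<in>X. avg N x * f x) = (\<Sum>n<Suc N. \<Sum>x\<in>X. P n x * f x) / real (Suc N)" for N f
    unfolding avg_def by (subst sum.swap) (simp add: sum_divide_distrib sum_distrib_right del: sum.lessThan_Suc)
  have avg_sum1: "(\<Sum>x\<in>X. avg N x) = 1" for N
    using avg_sum[of N "\<lambda>_. 1"] by (simp only: P_sum mult_1_right) simp
  have avg_le1: "avg N x \<le> 1" if "x \<in> X" for N x
    using member_le_sum[of x X "avg N"] that avg_nonneg avg_sum1[of N] fin by auto
  obtain \<rho> r where r: "strict_mono r" and \<rho>: "\<And>x. x \<in> X \<Longrightarrow> (\<lambda>k. avg (r k) x) \<longlonglongrightarrow> \<rho> x"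
    using finite_pointwise_convergent_subsequence[OF fin, of avg 1] avg_nonneg avg_le1
    by (metis abs_of_nonneg)
  have \<rho>_sum: "(\<lambda>k. \<Sum>x\<in>X. avg (r k) x * f x) \<longlonglongrightarrow> (\<Sum>x\<in>X. \<rho> x * f x)" for f
    by (intro tendsto_intros \<rho>)
  have "0 \<le> \<rho> x" if "x \<in> X" for x
    using LIMSEQ_le_const[OF \<rho>[OF that]] avg_nonneg[OF that] by blast
  moreover have "(\<Sum>x\<in>X. \<rho> x) = 1"
    using \<rho>_sum[of "\<lambda>_. 1"] avg_sum1 by (simp add: LIMSEQ_const_iff)
  moreover have "\<rho> y = (\<Sum>x\<in>X. \<rho> x * K x y)" if y: "y \<in> X" for y
  proof -
    \<comment> \<open>Applying \<open>K\<close> shifts the average by one time step, so the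
      difference telescopes and stationarity fails by at most \<open>1 / Suc N\<close>.\<close>
    have drift: "(\<Sum>x\<in>X. avg N x * K x y) - avg N y = (P (Suc N) y - P 0 y) / real (Suc N)" for N
    proof -
      have "(\<Sum>x\<in>X. avg N x * K x y) = (\<Sum>n<Suc N. P (Suc n) y) / real (Suc N)"
        by (simp only: avg_sum P_Suc)
      then show ?thesis
        using sum_lessThan_telescope[of "\<lambda>n. P n y" "Suc N"]
        by (simp add: avg_def sum_subtractf flip: diff_divide_distrib)
    qed
    have "(\<lambda>k. (P (Suc (r k)) y - P 0 y) / real (Suc (r k))) \<longlonglongrightarrow> 0"
    proof (rule Lim_null_comparison)
      show "(\<lambda>k. 1 * inverse (real (Suc (r k)))) \<longlonglongrightarrow> 0"
        using LIMSEQ_subseq_LIMSEQ[OF LIMSEQ_inverse_real_of_nat r] by (simp add: comp_def)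
      have "\<bar>P (Suc (r k)) y - P 0 y\<bar> \<le> 1" for k
        using P_nonneg[OF y] P_le1[OF y] by (smt (verit))
      then show "\<forall>\<^sub>F k in sequentially. norm ((P (Suc (r k)) y - P 0 y) / real (Suc (r k)))
          \<le> 1 * inverse (real (Suc (r k)))"
        by (auto simp: divide_simps simp del: of_nat_Suc)
    qed
    then have "(\<lambda>k. (\<Sum>x\<in>X. avg (r k) x * K x y) - avg (r k) y) \<longlonglongrightarrow> 0"
      by (simp add: drift)
    moreover have "(\<lambda>k. (\<Sum>x\<in>X. avg (r k) x * K x y) - avg (r k) y) \<longlonglongrightarrow> (\<Sum>x\<in>X. \<rho> x * K x y) - \<rho> y"
      by (intro tendsto_diff \<rho>_sum \<rho> y)
    ultimately show ?thesis
      using LIMSEQ_unique by fastforce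
  qed
  moreover have "(\<Sum>x\<in>X. \<rho> x * f x) \<le> (\<Sum>x\<in>X. \<pi> x * f x)" if "f \<in> \<F>" for f
  proof (rule LIMSEQ_le_const2[OF \<rho>_sum], intro exI allI impI)
    fix k :: nat
    have "(\<Sum>n<Suc (r k). \<Sum>x\<in>X. P n x * f x) \<le> real (Suc (r k)) * (\<Sum>x\<in>X. \<pi> x * f x)"
      using sum_bounded_above[of "{..<Suc (r k)}" "\<lambda>n. \<Sum>x\<in>X. P n x * f x"] P_dec[OF that]
      by simp
    then show "(\<Sum>x\<in>X. avg (r k) x * f x) \<le> (\<Sum>x\<in>X. \<pi> x * f x)"
      by (simp only: avg_sum) (simp add: field_simps)
  qed
  ultimately show ?thesis
    unfolding stationary_dist_def by blast
qed

text \<open>Weak Pareto optimality says that \<open>R\<close> misses the open quadrant below and to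
  the left of \<open>(P, D)\<close>. A separating line must pass through \<open>(P, D)\<close>, and
  its coefficients are nonnegative because the quadrant is unbounded in both directions.\<close>

lemma weak_pareto_supporting_line:
  fixes R :: "(real \<times> real) set"
  assumes "convex R" and "(P, D) \<in> R" and par: "\<And>P' D'. (P', D') \<in> R \<Longrightarrow> P \<le> P' \<or> D \<le> D'"
  shows "\<exists>k l. 0 \<le> k \<and> 0 \<le> l \<and> (k, l) \<noteq> (0, 0) \<and> (\<forall>(P', D')\<in>R. k * P + l * D \<le> k * P' + l * D')"
proof -
  let ?L = "{..<P} \<times> {..<D}"
  have "?L \<inter> R = {}" using par by fastforce
  moreover have "convex ?L" "?L \<noteq> {}" "R \<noteq> {}"
    using assms by (auto intro!: convex_Times convex_real_interval lt_ex)
  ultimately obtain a b where a: "a \<noteq> 0" and below: "\<forall>x\<in>?L. inner a x \<le> b" and above: "\<forall>x\<in>R. b \<le> inner a x"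
    using separating_hyperplane_sets[of ?L R] assms(1) by auto
  obtain k l where kl: "a = (k, l)" by fastforce
  have below': "k * x + l * y \<le> b" if "x < P" "y < D" for x y
    using below that by (auto simp: kl)
  have on: "b \<le> k * P + l * D"
    using above assms(2) by (force simp: kl)
  have k: "0 \<le> k"
  proof (rule ccontr)
    assume "\<not> 0 \<le> k"
    \<comment> \<open>This \<open>t\<close> makes \<open>k * (P - t)\<close> exceed
      \<open>k * P\<close> by one more than \<open>\<bar>l\<bar>\<close>, enough to pay for the
      change from \<open>D\<close> to \<open>D - 1\<close>.\<close>
    define t where "t = (1 + \<bar>l\<bar>) / - k"
    have "k * (P - t) + l * (D - 1) = k * P + l * D + (1 + \<bar>l\<bar>) - l"
      using \<open>\<not> 0 \<le> k\<close> by (simp add: t_def field_simps)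
    moreover have "t > 0" using \<open>\<not> 0 \<le> k\<close> by (auto simp: t_def intro!: divide_pos_neg simp: divide_less_0_iff)
    ultimately show False using below'[of "P - t" "D - 1"] on by auto
  qed
  have l: "0 \<le> l"
  proof (rule ccontr)
    assume "\<not> 0 \<le> l"
    define t where "t = (1 + \<bar>k\<bar>) / - l"
    have "k * (P - 1) + l * (D - t) = k * P + l * D + (1 + \<bar>k\<bar>) - k"
      using \<open>\<not> 0 \<le> l\<close> by (simp add: t_def field_simps)
    moreover have "t > 0" using \<open>\<not> 0 \<le> l\<close> by (auto simp: t_def intro!: divide_pos_neg simp: divide_less_0_iff)
    ultimately show False using below'[of "P - 1" "D - t"] on by auto
  qed
  have "k * P + l * D \<le> b"
  proof (rule field_le_epsilon)
    fix e :: real assume "0 < e"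
    \<comment> \<open>The corner itself is not in the open quadrant and is approached along the
      diagonal; the summand 1 keeps the denominator positive.\<close>
    define t where "t = e / (1 + k + l)"
    have t: "t > 0" "(k + l) * t \<le> e"
      using k l \<open>0 < e\<close> by (auto simp: t_def field_simps)
    have "k * (P - t) + l * (D - t) \<le> b" by (rule below') (use t in auto)
    then show "k * P + l * D \<le> b + e" using t by (simp add: algebra_simps)
  qed
  then have "\<forall>(P', D')\<in>R. k * P + l * D \<le> k * P' + l * D'"
    using above by (force simp: kl)
  then show ?thesis using k l a kl by (auto simp: zero_prod_def)
qed

subsection \<open>Optimal rates in one slot\<close>

lemma rates_iff: "A \<le> Q \<Longrightarrow> s \<in> rates A S Q q \<longleftrightarrow> s \<le> q \<and> s \<le> S \<and> q - s \<le> Q - A"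
  unfolding rates_def by auto

text \<open>\<open>g\<close> is the continuation value as a function of the residual queue. The
  holding cost does not depend on the rate and is left out.\<close>

definition best_rates ::
  "nat \<Rightarrow> nat \<Rightarrow> nat \<Rightarrow> (nat \<Rightarrow> real) \<Rightarrow> (nat \<Rightarrow> real) \<Rightarrow> nat \<Rightarrow> nat set" where
  "best_rates A S Q p g q =
     {s \<in> rates A S Q q. \<forall>s'\<in>rates A S Q q. p s + g (q - s) \<le> p s' + g (q - s')}"

context
  fixes A S Q :: nat
  assumes AS: "A \<le> S" and AQ: "A \<le> Q"
begin

lemma rates_nonempty: "q \<le> Q \<Longrightarrow> min q S \<in> rates A S Q q"
  using AS AQ by (auto simp: rates_iff)

text \<open>Take optimal rates \<open>s\<close> at \<open>i\<close> and \<open>t\<close> at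
  \<open>j\<close>. If \<open>s < t\<close>, one packet is traded between the rates and both
  residuals stay; otherwise the residuals satisfy \<open>i - s < j - t\<close> and one packet is
  traded between them. Feasibility survives because it bounds the rate and the residual separately.
  \<open>W\<close> is given by its two defining properties so that it can be any solution of the
  optimality equation.\<close>

lemma infimal_convolution_exchange_convex:
  assumes p: "exchange_convex S p" and g: "exchange_convex (Q - A) g"
    and le: "\<And>q s. q \<le> Q \<Longrightarrow> s \<in> rates A S Q q \<Longrightarrow> W q \<le> p s + g (q - s)"
    and att: "\<And>q. q \<le> Q \<Longrightarrow> \<exists>s\<in>rates A S Q q. W q = p s + g (q - s)"
  shows "exchange_convex Q W"
  unfolding exchange_convex_def
proof (intro allI impI)
  fix i j assume ij: "i < j \<and> j \<le> Q"
  obtain s where s: "s \<in> rates A S Q i" "W i = p s + g (i - s)" using att[of i] ij by auto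
  obtain t where t: "t \<in> rates A S Q j" "W j = p t + g (j - t)" using att[of j] ij by auto
  note R = s(1)[unfolded rates_iff[OF AQ]] t(1)[unfolded rates_iff[OF AQ]]
  show "W (Suc i) + W (j - 1) \<le> W i + W j"
  proof (cases "s < t")
    case True
    then have "W (Suc i) \<le> p (Suc s) + g (Suc i - Suc s)" "W (j - 1) \<le> p (t - 1) + g (j - 1 - (t - 1))"
      using R ij by (intro le; auto simp: rates_iff[OF AQ])+
    moreover have "Suc i - Suc s = i - s" "j - 1 - (t - 1) = j - t" using True R by auto
    ultimately show ?thesis using exchange_convexD[OF p True] R s(2) t(2) by auto
  next
    case False
    then have lt: "i - s < j - t" using R ij by auto
    then have "W (Suc i) \<le> p s + g (Suc i - s)" "W (j - 1) \<le> p t + g (j - 1 - t)"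
      using R ij by (intro le; auto simp: rates_iff[OF AQ])+
    moreover have "Suc i - s = Suc (i - s)" "j - 1 - t = j - t - 1" using R by auto
    ultimately show ?thesis using exchange_convexD[OF g lt] R s(2) t(2) by auto
  qed
qed

lemma best_rates_nonempty:
  assumes "q \<le> Q"
  shows "best_rates A S Q p g q \<noteq> {}"
proof -
  have fin: "finite (rates A S Q q)" by (simp add: rates_def)
  have ne: "rates A S Q q \<noteq> {}" using rates_nonempty[OF assms] by blast
  show ?thesis
    using arg_min_if_finite[OF fin ne, of "\<lambda>s. p s + g (q - s)"]
    unfolding best_rates_def by (force simp: not_less)
qed

lemma finite_best_rates: "finite (best_rates A S Q p g q)"
  by (simp add: best_rates_def rates_def)

context
  fixes p g :: "nat \<Rightarrow> real"
  assumes p: "exchange_convex S p" and g: "exchange_convex (Q - A) g"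
begin

text \<open>Rate \<open>t - 1\<close> at \<open>q\<close> leaves the residual of \<open>t\<close> at
  \<open>Suc q\<close>, and \<open>Suc s\<close> at \<open>Suc q\<close> leaves that of
  \<open>s\<close> at \<open>q\<close>. Only the power terms change, and convexity of
  \<open>p\<close> keeps their sum from rising, so both new rates are optimal.\<close>

lemma best_rates_gap:
  assumes s: "s \<in> best_rates A S Q p g q" and t: "t \<in> best_rates A S Q p g (Suc q)" and "s + 2 \<le> t"
  shows "t - 1 \<in> best_rates A S Q p g q" "Suc s \<in> best_rates A S Q p g (Suc q)"
proof -
  note R = s[unfolded best_rates_def rates_iff[OF AQ]] t[unfolded best_rates_def rates_iff[OF AQ]]
  have "t - 1 \<in> rates A S Q q" "Suc s \<in> rates A S Q (Suc q)"
    using R assms(3) by (auto simp: rates_iff[OF AQ])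
  moreover from this have "p s + g (q - s) \<le> p (t - 1) + g (q - (t - 1))"
      "p t + g (Suc q - t) \<le> p (Suc s) + g (Suc q - Suc s)"
    using s t by (auto simp: best_rates_def)
  moreover have "p (Suc s) + p (t - 1) \<le> p s + p t"
    using R assms(3) by (intro exchange_convexD[OF p]) auto
  moreover have "q - (t - 1) = Suc q - t" "Suc q - Suc s = q - s" using assms(3) by auto
  ultimately show "t - 1 \<in> best_rates A S Q p g q" "Suc s \<in> best_rates A S Q p g (Suc q)"
    using s t unfolding best_rates_def by fastforce+
qed

text \<open>Swapping the two rates keeps the total power and brings the two residuals closer
  together, so convexity of \<open>g\<close> makes both swapped rates optimal.\<close>

lemma best_rates_cross:
  assumes s: "s \<in> best_rates A S Q p g q" and t: "t \<in> best_rates A S Q p g (Suc q)" and "t < s"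
  shows "t \<in> best_rates A S Q p g q" "s \<in> best_rates A S Q p g (Suc q)"
proof -
  note R = s[unfolded best_rates_def rates_iff[OF AQ]] t[unfolded best_rates_def rates_iff[OF AQ]]
  have "t \<in> rates A S Q q" "s \<in> rates A S Q (Suc q)"
    using R assms(3) by (auto simp: rates_iff[OF AQ])
  moreover from this have "p s + g (q - s) \<le> p t + g (q - t)"
      "p t + g (Suc q - t) \<le> p s + g (Suc q - s)"
    using s t by (auto simp: best_rates_def)
  moreover have "g (Suc (q - s)) + g (Suc q - t - 1) \<le> g (q - s) + g (Suc q - t)"
    using R assms(3) by (intro exchange_convexD[OF g]) auto
  moreover have "Suc (q - s) = Suc q - s" "Suc q - t - 1 = q - t" using R assms(3) by auto
  ultimately show "t \<in> best_rates A S Q p g q" "s \<in> best_rates A S Q p g (Suc q)"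
    using s t unfolding best_rates_def by fastforce+
qed

text \<open>Moving both ends inwards by one raises neither the sum of the \<open>p\<close> terms nor
  the sum of the \<open>g\<close> terms, so the new ends are optimal again; induction on the
  width.\<close>

lemma best_rates_interval:
  assumes "s \<in> best_rates A S Q p g q" "t \<in> best_rates A S Q p g q" "s \<le> r" "r \<le> t"
  shows "r \<in> best_rates A S Q p g q"
  using assms
proof (induction "t - s" arbitrary: s t rule: less_induct)
  case less
  show ?case
  proof (cases "s < r \<and> r < t")
    case True
    note R = less.prems(1,2)[unfolded best_rates_def rates_iff[OF AQ]]
    have in_R: "Suc s \<in> rates A S Q q" "t - 1 \<in> rates A S Q q"
      using R True by (auto simp: rates_iff[OF AQ])
    have "p (Suc s) + p (t - 1) \<le> p s + p t"
      using R True by (intro exchange_convexD[OF p]) auto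
    moreover have "g (q - (t - 1)) + g (q - Suc s) \<le> g (q - t) + g (q - s)"
    proof -
      have "q - (t - 1) = Suc (q - t)" "q - Suc s = q - s - 1" using R True by auto
      then show ?thesis
        using R True exchange_convexD[OF g, of "q - t" "q - s"] by auto
    qed
    moreover have "p s + g (q - s) \<le> p (Suc s) + g (q - Suc s)" "p t + g (q - t) \<le> p (t - 1) + g (q - (t - 1))"
      using less.prems in_R by (auto simp: best_rates_def)
    ultimately have eq: "p (Suc s) + g (q - Suc s) = p s + g (q - s)"
        "p (t - 1) + g (q - (t - 1)) = p t + g (q - t)" by linarith+
    have "Suc s \<in> best_rates A S Q p g q" "t - 1 \<in> best_rates A S Q p g q"
      using less.prems(1,2) in_R unfolding best_rates_def mem_Collect_eq eq by auto
    then show ?thesis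
      using less.hyps[of "t - 1" "Suc s"] True by auto
  next
    case False
    then show ?thesis using less.prems by (metis le_neq_implies_less)
  qed
qed

text \<open>A fall, or a rise by two or more, would by an exchange produce an optimal rate above one
  of the two maxima.\<close>

lemma Max_best_rates_step:
  assumes "Suc q \<le> Q"
  shows "Max (best_rates A S Q p g q) \<le> Max (best_rates A S Q p g (Suc q)) \<and> Max (best_rates A S Q p g (Suc q)) \<le> Suc (Max (best_rates A S Q p g q))"
proof -
  let ?u = "Max (best_rates A S Q p g q)" and ?v = "Max (best_rates A S Q p g (Suc q))"
  have u: "?u \<in> best_rates A S Q p g q" "\<And>s. s \<in> best_rates A S Q p g q \<Longrightarrow> s \<le> ?u" and v: "?v \<in> best_rates A S Q p g (Suc q)" "\<And>s. s \<in> best_rates A S Q p g (Suc q) \<Longrightarrow> s \<le> ?v"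
    using assms finite_best_rates best_rates_nonempty by (auto intro!: Max_in)
  have "?v - 1 \<le> ?u" if "?u + 2 \<le> ?v"
    using u(2) best_rates_gap(1)[OF u(1) v(1) that] .
  moreover have "?u \<le> ?v" if "?v < ?u"
    using v(2) best_rates_cross(2)[OF u(1) v(1) that] .
  ultimately show ?thesis by linarith
qed

lemma Min_best_rates_step:
  assumes "Suc q \<le> Q"
  shows "Min (best_rates A S Q p g q) \<le> Min (best_rates A S Q p g (Suc q)) \<and> Min (best_rates A S Q p g (Suc q)) \<le> Suc (Min (best_rates A S Q p g q))"
proof -
  let ?u = "Min (best_rates A S Q p g q)" and ?v = "Min (best_rates A S Q p g (Suc q))"
  have u: "?u \<in> best_rates A S Q p g q" "\<And>s. s \<in> best_rates A S Q p g q \<Longrightarrow> ?u \<le> s" and v: "?v \<in> best_rates A S Q p g (Suc q)" "\<And>s. s \<in> best_rates A S Q p g (Suc q) \<Longrightarrow> ?v \<le> s"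
    using assms finite_best_rates best_rates_nonempty by (auto intro!: Min_in)
  have "?v \<le> Suc ?u" if "?u + 2 \<le> ?v"
    using v(2) best_rates_gap(2)[OF u(1) v(1) that] .
  moreover have "?u \<le> ?v" if "?v < ?u"
    using u(2) best_rates_cross(1)[OF u(1) v(1) that] .
  ultimately show ?thesis by linarith
qed

end

end

subsection \<open>Occupation measures of policies\<close>

locale controlled_queue =
  fixes A S Q :: nat and \<gamma> :: "nat \<Rightarrow> nat \<Rightarrow> real"
  assumes A_pos: "0 < A" and AS: "A \<le> S" and AQ: "A \<le> Q" and ergodic: "ergodic_chain {..A} \<gamma>"
begin

abbreviation R where "R \<equiv> rates A S Q"
abbreviation X where "X \<equiv> states A Q"

lemmas R_iff = rates_iff[OF AQ]

lemma X_iff: "(q, a) \<in> X \<longleftrightarrow> q \<le> Q \<and> a \<le> A"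
  by (simp add: states_def)

lemma finite_X: "finite X" by (simp add: states_def)

lemma finite_R: "finite (R q)" by (simp add: rates_def)

lemma \<gamma>_nonneg: "a \<le> A \<Longrightarrow> a' \<le> A \<Longrightarrow> 0 \<le> \<gamma> a a'"
  using ergodic by (auto simp: ergodic_chain_def stochastic_on_def)

lemma \<gamma>_sum: "a \<le> A \<Longrightarrow> (\<Sum>a'\<le>A. \<gamma> a a') = 1"
  using ergodic by (auto simp: ergodic_chain_def stochastic_on_def)

text \<open>The argument \<open>y\<close> is the queue length after transmission, before the next arrivals.\<close>

definition cont :: "(nat \<times> nat \<Rightarrow> real) \<Rightarrow> nat \<Rightarrow> nat \<Rightarrow> real" where
  "cont f a y = (\<Sum>a'\<le>A. \<gamma> a a' * f (y + a', a'))"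

lemma cont_const: "a \<le> A \<Longrightarrow> cont (\<lambda>_. c) a y = c"
  by (simp add: cont_def \<gamma>_sum flip: sum_distrib_right)

lemma cont_mono:
  "a \<le> A \<Longrightarrow> (\<And>a'. a' \<le> A \<Longrightarrow> f (y + a', a') \<le> g (z + a', a')) \<Longrightarrow> cont f a y \<le> cont g a z"
  unfolding cont_def by (intro sum_mono mult_left_mono) (auto simp: \<gamma>_nonneg)

lemma cont_diff_const: "a \<le> A \<Longrightarrow> cont (\<lambda>x. f x - c) a y = cont f a y - c"
  by (simp add: cont_def right_diff_distrib sum_subtractf \<gamma>_sum flip: sum_distrib_right)

lemma sum_states: "(\<Sum>x\<in>X. f x) = (\<Sum>q\<le>Q. \<Sum>a\<le>A. f (q, a))"
  by (simp add: states_def sum.cartesian_product)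

lemma policy_nonneg: "policy A S Q F \<Longrightarrow> q \<le> Q \<Longrightarrow> a \<le> A \<Longrightarrow> 0 \<le> F q a s"
  and policy_sum: "policy A S Q F \<Longrightarrow> q \<le> Q \<Longrightarrow> a \<le> A \<Longrightarrow> (\<Sum>s\<le>S. F q a s) = 1"
  and policy_support: "policy A S Q F \<Longrightarrow> q \<le> Q \<Longrightarrow> a \<le> A \<Longrightarrow> F q a s \<noteq> 0 \<Longrightarrow> s \<in> R q"
  by (auto simp: policy_def)

text \<open>Only feasible rates carry mass, and for these \<open>s \<le> q\<close> and
  \<open>q - s + a' \<le> Q\<close>. Hence the subtraction is exact and every successor lies in the
  state space.\<close>

lemma kernel_expectation:
  assumes F: "policy A S Q F" and qa: "q \<le> Q" "a \<le> A"
  shows "(\<Sum>y\<in>X. joint_kernel S \<gamma> F (q, a) y * f y) = (\<Sum>s\<le>S. F q a s * cont f a (q - s))"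
proof -
  have "(\<Sum>y\<in>X. joint_kernel S \<gamma> F (q, a) y * f y)
      = (\<Sum>q'\<le>Q. \<Sum>a'\<le>A. \<Sum>s\<le>S. if q' + s = q + a' then F q a s * \<gamma> a a' * f (q', a') else 0)"
    unfolding sum_states joint_kernel_def
    by (intro sum.cong refl) (auto simp: sum_distrib_right intro!: sum.cong)
  also have "\<dots> = (\<Sum>s\<le>S. \<Sum>a'\<le>A. \<Sum>q'\<le>Q. if q' + s = q + a' then F q a s * \<gamma> a a' * f (q', a') else 0)"
    by (subst sum.swap, subst sum.swap[of _ "{..S}"], subst sum.swap) (rule refl)
  also have "\<dots> = (\<Sum>s\<le>S. F q a s * cont f a (q - s))"
  proof (rule sum.cong[OF refl])
    fix s assume s: "s \<in> {..S}"
    show "(\<Sum>a'\<le>A. \<Sum>q'\<le>Q. if q' + s = q + a' then F q a s * \<gamma> a a' * f (q', a') else 0)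
        = F q a s * cont f a (q - s)"
    proof (cases "F q a s = 0")
      case False
      then have sR: "s \<le> q" "q - s \<le> Q - A" using policy_support[OF F qa] R_iff by auto
      have "(\<Sum>q'\<le>Q. if q' + s = q + a' then F q a s * \<gamma> a a' * f (q', a') else 0)
          = F q a s * (\<gamma> a a' * f (q - s + a', a'))" if "a' \<le> A" for a'
      proof -
        have "q - s + a' \<in> {..Q}" using sR that AQ by auto
        moreover have "q' + s = q + a' \<longleftrightarrow> q - s + a' = q'" for q' using sR by auto
        ultimately show ?thesis by (simp add: mult.assoc)
      qed
      then show ?thesis by (simp add: cont_def sum_distrib_left)
    qed (simp add: cong: if_cong)
  qed
  finally show ?thesis .
qed

lemma kernel_stochastic:
  assumes F: "policy A S Q F"
  shows "stochastic_on X (joint_kernel S \<gamma> F)"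
  unfolding stochastic_on_def
proof safe
  fix q a q' a' assume "(q, a) \<in> X" "(q', a') \<in> X"
  then show "0 \<le> joint_kernel S \<gamma> F (q, a) (q', a')"
    using F by (auto simp: joint_kernel_def X_iff \<gamma>_nonneg policy_nonneg intro!: sum_nonneg)
next
  fix q a assume qa: "(q, a) \<in> X"
  then show "(\<Sum>y\<in>X. joint_kernel S \<gamma> F (q, a) y) = 1"
    using kernel_expectation[OF F, of q a "\<lambda>_. 1"] policy_sum[OF F, of q a]
    by (simp add: X_iff cont_const)
qed

abbreviation stationary where
  "stationary F \<pi> \<equiv> stationary_dist X (joint_kernel S \<gamma> F) \<pi>"

lemma stationary_nonneg: "stationary F \<pi> \<Longrightarrow> x \<in> X \<Longrightarrow> 0 \<le> \<pi> x"
  by (auto simp: stationary_dist_def)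

lemma stationary_sum: "stationary F \<pi> \<Longrightarrow> (\<Sum>x\<in>X. \<pi> x) = 1"
  by (auto simp: stationary_dist_def)

lemma kernel_swap:
  assumes F: "policy A S Q F"
  shows "(\<Sum>y\<in>X. (\<Sum>x\<in>X. \<pi> x * joint_kernel S \<gamma> F x y) * f y)
       = (\<Sum>(q, a)\<in>X. \<pi> (q, a) * (\<Sum>s\<le>S. F q a s * cont f a (q - s)))"
proof -
  have "(\<Sum>y\<in>X. (\<Sum>x\<in>X. \<pi> x * joint_kernel S \<gamma> F x y) * f y)
      = (\<Sum>x\<in>X. \<pi> x * (\<Sum>y\<in>X. joint_kernel S \<gamma> F x y * f y))"
    unfolding sum_distrib_left sum_distrib_right by (subst sum.swap) (simp add: mult.assoc)
  also have "\<dots> = (\<Sum>(q, a)\<in>X. \<pi> (q, a) * (\<Sum>s\<le>S. F q a s * cont f a (q - s)))"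
    by (intro sum.cong) (auto simp: X_iff kernel_expectation[OF F])
  finally show ?thesis .
qed

lemma stationary_expectation:
  assumes F: "policy A S Q F" and st: "stationary F \<pi>"
  shows "(\<Sum>x\<in>X. \<pi> x * f x) = (\<Sum>(q, a)\<in>X. \<pi> (q, a) * (\<Sum>s\<le>S. F q a s * cont f a (q - s)))"
  unfolding kernel_swap[OF F, symmetric] using st by (intro sum.cong) (auto simp: stationary_dist_def)

text \<open>Indicator functions recover the pointwise balance equation, so stationarity can be
  checked through expectations, which are linear in the occupation measure.\<close>

lemma stationaryI:
  assumes F: "policy A S Q F" and nn: "\<And>x. x \<in> X \<Longrightarrow> 0 \<le> \<pi> x" and s1: "(\<Sum>x\<in>X. \<pi> x) = 1"
    and ex: "\<And>f. (\<Sum>x\<in>X. \<pi> x * f x) = (\<Sum>(q, a)\<in>X. \<pi> (q, a) * (\<Sum>s\<le>S. F q a s * cont f a (q - s)))"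
  shows "stationary F \<pi>"
  unfolding stationary_dist_def
proof (intro conjI ballI)
  fix y assume y: "y \<in> X"
  have pick: "(\<Sum>x\<in>X. m x * of_bool (x = y)) = m y" for m :: "_ \<Rightarrow> real"
    using y finite_X by (simp add: of_bool_def if_distrib cong: if_cong)
  show "\<pi> y = (\<Sum>x\<in>X. \<pi> x * joint_kernel S \<gamma> F x y)"
    using ex[of "\<lambda>x. of_bool (x = y)"] kernel_swap[OF F, of \<pi> "\<lambda>x. of_bool (x = y)"]
    unfolding pick by simp
qed (use nn s1 in auto)

text \<open>The convex combination of the two occupation measures is split again into a state
  distribution \<open>\<rho>\<close> and conditional rate probabilities \<open>H\<close>. The last
  conclusion localises the randomisation: \<open>H\<close> agrees with \<open>F\<close> and
  \<open>G\<close> wherever these two agree.\<close>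

lemma mix_policies:
  assumes F: "policy A S Q F" "stationary F \<pi>" and G: "policy A S Q G" "stationary G \<sigma>"
    and t: "0 \<le> t" "t \<le> 1"
  shows "\<exists>H \<rho>. policy A S Q H \<and> stationary H \<rho> \<and> (\<forall>x\<in>X. \<rho> x = (1 - t) * \<pi> x + t * \<sigma> x)
    \<and> (\<forall>(q, a)\<in>X. \<forall>s. \<rho> (q, a) * H q a s = (1 - t) * \<pi> (q, a) * F q a s + t * \<sigma> (q, a) * G q a s)
    \<and> (\<forall>(q, a)\<in>X. \<exists>\<tau>. 0 \<le> \<tau> \<and> \<tau> \<le> 1 \<and> (\<forall>s. H q a s = (1 - \<tau>) * F q a s + \<tau> * G q a s))"
proof -
  define \<rho> where "\<rho> x = (1 - t) * \<pi> x + t * \<sigma> x" for x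
  \<comment> \<open>The conditional weight of the second policy in state \<open>x\<close>. Where
    \<open>\<rho> x = 0\<close> the quotient is 0 by convention, and \<open>H\<close> follows
    \<open>F\<close> there.\<close>
  define \<tau> where "\<tau> x = t * \<sigma> x / \<rho> x" for x
  define H where "H q a s = (1 - \<tau> (q, a)) * F q a s + \<tau> (q, a) * G q a s" for q a s
  have parts: "0 \<le> (1 - t) * \<pi> x" "0 \<le> t * \<sigma> x" if "x \<in> X" for x
    using that t stationary_nonneg[OF F(2)] stationary_nonneg[OF G(2)] by auto
  have \<tau>: "0 \<le> \<tau> x" "\<tau> x \<le> 1" if "x \<in> X" for x
    using parts[OF that] by (auto simp: \<tau>_def \<rho>_def divide_simps)
  have \<tau>\<rho>: "\<rho> x * \<tau> x = t * \<sigma> x" "\<rho> x * (1 - \<tau> x) = (1 - t) * \<pi> x" if "x \<in> X" for x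
  proof -
    show "\<rho> x * \<tau> x = t * \<sigma> x"
      using parts[OF that] by (cases "\<rho> x = 0") (auto simp: \<tau>_def \<rho>_def add_nonneg_eq_0_iff)
    then show "\<rho> x * (1 - \<tau> x) = (1 - t) * \<pi> x"
      by (simp add: right_diff_distrib) (simp add: \<rho>_def)
  qed
  have flow: "\<rho> (q, a) * H q a s = (1 - t) * \<pi> (q, a) * F q a s + t * \<sigma> (q, a) * G q a s"
    if "(q, a) \<in> X" for q a s
  proof -
    have "\<rho> (q, a) * H q a s = (\<rho> (q, a) * (1 - \<tau> (q, a))) * F q a s + (\<rho> (q, a) * \<tau> (q, a)) * G q a s"
      by (simp add: H_def algebra_simps)
    then show ?thesis by (simp only: \<tau>\<rho>[OF that])
  qed
  have H: "policy A S Q H"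
    unfolding policy_def
  proof (intro allI impI conjI)
    fix q a assume qa: "q \<le> Q" "a \<le> A"
    then have x: "(q, a) \<in> X" by (simp add: X_iff)
    show "0 \<le> H q a s" for s
      using \<tau>[OF x] policy_nonneg[OF F(1) qa] policy_nonneg[OF G(1) qa] by (auto simp: H_def)
    show "(\<Sum>s\<le>S. H q a s) = 1"
      using policy_sum[OF F(1) qa] policy_sum[OF G(1) qa]
      by (simp add: H_def sum.distrib flip: sum_distrib_left)
    show "H q a s = 0" if "s \<notin> R q" for s
    proof -
      have "F q a s = 0" "G q a s = 0"
        using that policy_support[OF F(1) qa] policy_support[OF G(1) qa] by blast+
      then show ?thesis by (simp add: H_def)
    qed
  qed
  have "stationary H \<rho>"
  proof (rule stationaryI[OF H])
    show "0 \<le> \<rho> x" if "x \<in> X" for x using parts[OF that] by (simp add: \<rho>_def)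
    show "(\<Sum>x\<in>X. \<rho> x) = 1"
      using stationary_sum[OF F(2)] stationary_sum[OF G(2)] by (simp add: \<rho>_def sum.distrib flip: sum_distrib_left)
    fix f
    let ?e = "\<lambda>F \<pi>. (\<Sum>(q, a)\<in>X. \<pi> (q, a) * (\<Sum>s\<le>S. F q a s * cont f a (q - s)))"
    have "(\<Sum>x\<in>X. \<rho> x * f x) = (1 - t) * (\<Sum>x\<in>X. \<pi> x * f x) + t * (\<Sum>x\<in>X. \<sigma> x * f x)"
      by (simp add: \<rho>_def sum.distrib sum_distrib_left distrib_right mult.assoc)
    also have "\<dots> = (1 - t) * ?e F \<pi> + t * ?e G \<sigma>"
      by (simp only: stationary_expectation[OF F] stationary_expectation[OF G])
    also have "\<dots> = (\<Sum>(q, a)\<in>X. \<Sum>s\<le>S. ((1 - t) * \<pi> (q, a) * F q a s + t * \<sigma> (q, a) * G q a s) * cont f a (q - s))"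
      by (simp add: sum_distrib_left sum.distrib distrib_right mult.assoc split_def)
    also have "\<dots> = ?e H \<rho>"
      by (intro sum.cong refl) (auto simp: sum_distrib_left flow simp flip: mult.assoc intro!: sum.cong)
    finally show "(\<Sum>x\<in>X. \<rho> x * f x) = ?e H \<rho>" .
  qed
  moreover have "\<exists>\<tau>. 0 \<le> \<tau> \<and> \<tau> \<le> 1 \<and> (\<forall>s. H q a s = (1 - \<tau>) * F q a s + \<tau> * G q a s)"
    if "(q, a) \<in> X" for q a
    using \<tau>[OF that] by (intro exI[of _ "\<tau> (q, a)"]) (simp add: H_def)
  moreover have "\<forall>x\<in>X. \<rho> x = (1 - t) * \<pi> x + t * \<sigma> x" by (simp add: \<rho>_def)
  ultimately show ?thesis
    using H flow by (intro exI[of _ H] exI[of _ \<rho>]) blast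
qed

text \<open>With \<open>\<F>\<close> empty this is mere existence; with \<open>\<F>\<close> a class
  of monotone functions it compares queue lengths.\<close>

lemma stationary_exists:
  assumes F: "policy A S Q F" and nn: "\<And>x. x \<in> X \<Longrightarrow> 0 \<le> \<pi> x" and s1: "(\<Sum>x\<in>X. \<pi> x) = 1"
    and inv: "\<And>f. f \<in> \<F> \<Longrightarrow> (\<lambda>x. \<Sum>y\<in>X. joint_kernel S \<gamma> F x y * f y) \<in> \<F>"
    and dec: "\<And>f. f \<in> \<F> \<Longrightarrow> (\<Sum>(q, a)\<in>X. \<pi> (q, a) * (\<Sum>s\<le>S. F q a s * cont f a (q - s))) \<le> (\<Sum>x\<in>X. \<pi> x * f x)"
  shows "\<exists>\<rho>. stationary F \<rho> \<and> (\<forall>f\<in>\<F>. (\<Sum>x\<in>X. \<rho> x * f x) \<le> (\<Sum>x\<in>X. \<pi> x * f x))"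
proof (rule stationary_dist_exists[OF finite_X kernel_stochastic[OF F] nn s1 inv])
  fix f assume "f \<in> \<F>"
  moreover have "(\<Sum>x\<in>X. \<pi> x * (\<Sum>y\<in>X. joint_kernel S \<gamma> F x y * f y)) =
     (\<Sum>(q, a)\<in>X. \<pi> (q, a) * (\<Sum>s\<le>S. F q a s * cont f a (q - s)))"
    by (intro sum.cong) (auto simp: X_iff kernel_expectation[OF F])
  ultimately show "(\<Sum>x\<in>X. \<pi> x * (\<Sum>y\<in>X. joint_kernel S \<gamma> F x y * f y)) \<le> (\<Sum>x\<in>X. \<pi> x * f x)"
    using dec by simp
qed auto

end

subsection \<open>The optimality equation\<close>

locale queue_costs = controlled_queue +
  fixes p :: "nat \<Rightarrow> real" and \<mu> :: real
  assumes p_convex: "exchange_convex S p" and p_mono: "mono_on {..S} p"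
    and p_nonneg: "s \<le> S \<Longrightarrow> 0 \<le> p s" and \<mu>_nonneg: "0 \<le> \<mu>"
begin

text \<open>For \<open>v = 0\<close> this is a step of discounted value iteration from \<open>V\<close> to \<open>V'\<close>; for \<open>\<beta> = 1\<close> and
  \<open>V' = V\<close> it is the optimality equation of the average cost \<open>v\<close>.\<close>

definition bellman :: "real \<Rightarrow> real \<Rightarrow> (nat \<times> nat \<Rightarrow> real) \<Rightarrow> (nat \<times> nat \<Rightarrow> real) \<Rightarrow> bool" where
  "bellman v \<beta> V V' \<longleftrightarrow> (\<forall>q\<le>Q. \<forall>a\<le>A.
     (\<forall>s\<in>R q. v + V' (q, a) \<le> p s + \<mu> * q + \<beta> * cont V a (q - s)) \<and>
     (\<exists>s\<in>R q. v + V' (q, a) = p s + \<mu> * q + \<beta> * cont V a (q - s)))"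

lemma bellman_le:
  "bellman v \<beta> V V' \<Longrightarrow> q \<le> Q \<Longrightarrow> a \<le> A \<Longrightarrow> s \<in> R q
    \<Longrightarrow> v + V' (q, a) \<le> p s + \<mu> * q + \<beta> * cont V a (q - s)"
  and bellman_attained:
  "bellman v \<beta> V V' \<Longrightarrow> q \<le> Q \<Longrightarrow> a \<le> A
    \<Longrightarrow> \<exists>s\<in>R q. v + V' (q, a) = p s + \<mu> * q + \<beta> * cont V a (q - s)"
  by (auto simp: bellman_def)

definition convex_mono :: "(nat \<times> nat \<Rightarrow> real) \<Rightarrow> bool" where
  "convex_mono V \<longleftrightarrow> (\<forall>a\<le>A. exchange_convex Q (\<lambda>q. V (q, a)) \<and> (\<forall>q<Q. V (q, a) \<le> V (Suc q, a)))"

lemma cont_convex_mono: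
  assumes V: "convex_mono V" and a: "a \<le> A"
  shows "exchange_convex (Q - A) (cont V a)" and "\<And>y. y < Q - A \<Longrightarrow> cont V a y \<le> cont V a (Suc y)"
proof -
  show "exchange_convex (Q - A) (cont V a)"
    unfolding exchange_convex_def
  proof (intro allI impI)
    fix i j assume ij: "i < j \<and> j \<le> Q - A"
    have "V (Suc i + a', a') + V (j - 1 + a', a') \<le> V (i + a', a') + V (j + a', a')" if a': "a' \<le> A" for a'
    proof -
      have "exchange_convex Q (\<lambda>q. V (q, a'))" using V a' by (auto simp: convex_mono_def)
      from exchange_convexD[OF this, of "i + a'" "j + a'"] show ?thesis
        using ij a' AQ by auto
    qed
    then show "cont V a (Suc i) + cont V a (j - 1) \<le> cont V a i + cont V a j"
      unfolding cont_def sum.distrib[symmetric] distrib_left[symmetric]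
      by (intro sum_mono mult_left_mono) (use a in \<open>auto simp: \<gamma>_nonneg\<close>)
  qed
  show "cont V a y \<le> cont V a (Suc y)" if "y < Q - A" for y
    using that V by (intro cont_mono[OF a]) (auto simp: convex_mono_def)
qed

text \<open>The rate used at \<open>Suc q\<close> is also feasible at \<open>q\<close> and leaves a
  shorter residual, unless it empties the queue, in which case one packet less empties it at
  \<open>q\<close>. The surplus is the holding cost of one packet; the bound \<open>\<mu>\<close> on
  the slope later forces transmission at full rate when power is free.\<close>

lemma bellman_increment:
  assumes b: "bellman v \<beta> V V'" and V: "convex_mono V" and \<beta>: "0 \<le> \<beta>" and a: "a \<le> A" and q: "q < Q"
  shows "V' (q, a) + \<mu> \<le> V' (Suc q, a)"
proof -
  note cont = cont_convex_mono[OF V a]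
  obtain s where s: "s \<in> R (Suc q)" "v + V' (Suc q, a) = p s + \<mu> * Suc q + \<beta> * cont V a (Suc q - s)"
    using bellman_attained[OF b _ a, of "Suc q"] q by auto
  have \<mu>: "\<mu> * Suc q = \<mu> * q + \<mu>" by (simp add: algebra_simps)
  show ?thesis
  proof (cases "s \<le> q")
    case True
    then have "s \<in> R q" using s(1) by (auto simp: R_iff)
    moreover have "\<beta> * cont V a (q - s) \<le> \<beta> * cont V a (Suc q - s)"
      using True s(1) cont(2)[of "q - s"] by (intro mult_left_mono[OF _ \<beta>]) (auto simp: R_iff Suc_diff_le)
    ultimately show ?thesis using bellman_le[OF b _ a, of q s] q s(2) \<mu> by simp
  next
    case False
    then have "s = Suc q" using s(1) by (auto simp: R_iff)
    moreover have "q \<in> R q" "p q \<le> p (Suc q)"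
      using s(1) \<open>s = Suc q\<close> by (auto simp: R_iff intro!: mono_onD[OF p_mono])
    ultimately show ?thesis using bellman_le[OF b _ a, of q q] q s(2) \<mu> by simp
  qed
qed

text \<open>Without the linear term \<open>\<mu> * q\<close> the new value is an infimal convolution
  of convex functions. Adding the term back is harmless because an exchange preserves
  \<open>i + j\<close>.\<close>

lemma bellman_convex_mono:
  assumes b: "bellman v \<beta> V V'" and V: "convex_mono V" and \<beta>: "0 \<le> \<beta>"
  shows "convex_mono V'"
  unfolding convex_mono_def
proof (intro allI impI conjI)
  fix a assume a: "a \<le> A"
  note cont = cont_convex_mono[OF V a]
  let ?W = "\<lambda>q. v + V' (q, a) - \<mu> * q"
  have "exchange_convex Q ?W"
  proof (rule infimal_convolution_exchange_convex[OF AS AQ p_convex exchange_convex_scale[OF cont(1) \<beta>]])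
    show "?W q \<le> p s + \<beta> * cont V a (q - s)" if "q \<le> Q" "s \<in> R q" for q s
      using bellman_le[OF b that(1) a that(2)] by simp
    show "\<exists>s\<in>R q. ?W q = p s + \<beta> * cont V a (q - s)" if "q \<le> Q" for q
      using bellman_attained[OF b that a] by (auto simp: algebra_simps)
  qed
  then show "exchange_convex Q (\<lambda>q. V' (q, a))"
    unfolding exchange_convex_def
  proof (intro allI impI)
    fix i j assume W: "\<forall>i j. i < j \<and> j \<le> Q \<longrightarrow> ?W (Suc i) + ?W (j - 1) \<le> ?W i + ?W j" and ij: "i < j \<and> j \<le> Q"
    have "?W (Suc i) + ?W (j - 1) \<le> ?W i + ?W j" using W ij by blast
    moreover have "real (Suc i) + real (j - 1) = real i + real j" using ij by auto
    then have "\<mu> * real (Suc i) + \<mu> * real (j - 1) = \<mu> * real i + \<mu> * real j"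
      unfolding distrib_left[symmetric] by simp
    ultimately show "V' (Suc i, a) + V' (j - 1, a) \<le> V' (i, a) + V' (j, a)" by linarith
  qed
  show "V' (q, a) \<le> V' (Suc q, a)" if "q < Q" for q
    using bellman_increment[OF b V \<beta> a that] \<mu>_nonneg by linarith
qed

lemma convex_mono_limit:
  assumes V: "\<And>k. convex_mono (V k)" and lim: "\<And>x. x \<in> X \<Longrightarrow> (\<lambda>k. V k x) \<longlonglongrightarrow> W x"
  shows "convex_mono W"
  unfolding convex_mono_def exchange_convex_def
proof (intro allI impI conjI)
  fix a i j assume a: "a \<le> A" and ij: "i < j \<and> j \<le> Q"
  have "V k (Suc i, a) + V k (j - 1, a) \<le> V k (i, a) + V k (j, a)" for k
    using V[of k] a ij by (auto simp: convex_mono_def exchange_convex_def)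
  moreover have "(\<lambda>k. V k (Suc i, a) + V k (j - 1, a)) \<longlonglongrightarrow> W (Suc i, a) + W (j - 1, a)"
      "(\<lambda>k. V k (i, a) + V k (j, a)) \<longlonglongrightarrow> W (i, a) + W (j, a)"
    using a ij by (auto intro!: tendsto_add lim simp: X_iff)
  ultimately show "W (Suc i, a) + W (j - 1, a) \<le> W (i, a) + W (j, a)"
    by (intro LIMSEQ_le) auto
next
  fix a q assume "a \<le> A" "q < Q"
  then show "W (q, a) \<le> W (Suc q, a)"
    using V lim by (intro LIMSEQ_le[of "\<lambda>k. V k (q, a)" _ "\<lambda>k. V k (Suc q, a)"]) (auto simp: X_iff convex_mono_def)
qed

lemma cont_limit:
  assumes "\<And>x. x \<in> X \<Longrightarrow> (\<lambda>k. V k x) \<longlonglongrightarrow> W x" and "y \<le> Q - A"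
  shows "(\<lambda>k. cont (V k) a y) \<longlonglongrightarrow> cont W a y"
  unfolding cont_def using AQ assms(2) by (intro tendsto_intros assms(1)) (auto simp: X_iff)

text \<open>Attainment passes to the limit because there are finitely many rates.\<close>

lemma bellman_limit:
  assumes b: "\<And>k. bellman (v k) (\<beta> k) (V k) (V' k)"
    and v: "v \<longlonglongrightarrow> w" and \<beta>: "\<beta> \<longlonglongrightarrow> c"
    and V: "\<And>x. x \<in> X \<Longrightarrow> (\<lambda>k. V k x) \<longlonglongrightarrow> W x" and V': "\<And>x. x \<in> X \<Longrightarrow> (\<lambda>k. V' k x) \<longlonglongrightarrow> W' x"
  shows "bellman w c W W'"
proof -
  have "(\<forall>s\<in>R q. w + W' (q, a) \<le> p s + \<mu> * q + c * cont W a (q - s)) \<and>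
     (\<exists>s\<in>R q. w + W' (q, a) = p s + \<mu> * q + c * cont W a (q - s))" if qa: "q \<le> Q" "a \<le> A" for q a
  proof -
    let ?l = "\<lambda>k. v k + V' k (q, a)" and ?r = "\<lambda>s k. p s + \<mu> * q + \<beta> k * cont (V k) a (q - s)"
    let ?r' = "\<lambda>s. p s + \<mu> * q + c * cont W a (q - s)"
    have l: "?l \<longlonglongrightarrow> w + W' (q, a)"
      using qa by (intro tendsto_add v V') (auto simp: X_iff)
    have r: "?r s \<longlonglongrightarrow> ?r' s" if "s \<in> R q" for s
      using that by (intro tendsto_intros \<beta> cont_limit V) (auto simp: R_iff)
    have le: "w + W' (q, a) \<le> ?r' s" if "s \<in> R q" for s
      using LIMSEQ_le[OF l r[OF that]] bellman_le[OF b qa that] by blast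
    moreover have "\<exists>s\<in>R q. w + W' (q, a) = ?r' s"
    proof (rule ccontr)
      assume "\<not> ?thesis"
      then have "\<forall>s\<in>R q. w + W' (q, a) < ?r' s" using le by force
      then have "\<forall>s\<in>R q. \<forall>\<^sub>F k in sequentially. 0 < ?r s k - ?l k"
        using tendsto_diff[OF r l] by (intro ballI order_tendstoD(1)) auto
      then have "\<forall>\<^sub>F k in sequentially. \<forall>s\<in>R q. 0 < ?r s k - ?l k"
        using finite_R by (simp add: eventually_ball_finite)
      then obtain k where "\<forall>s\<in>R q. 0 < ?r s k - ?l k"
        using eventually_happens'[OF sequentially_bot] by blast
      then show False using bellman_attained[OF b qa, of k] by force
    qed
    ultimately show ?thesis by blast
  qed
  then show ?thesis by (simp add: bellman_def)
qed

definition value_step :: "real \<Rightarrow> (nat \<times> nat \<Rightarrow> real) \<Rightarrow> nat \<times> nat \<Rightarrow> real" where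
  "value_step \<beta> V = (\<lambda>(q, a). Min ((\<lambda>s. p s + \<mu> * q + \<beta> * cont V a (q - s)) ` R q))"

lemma bellman_value_step: "bellman 0 \<beta> V (value_step \<beta> V)"
  unfolding bellman_def
proof (intro allI impI)
  fix q a assume "q \<le> Q" "a \<le> A"
  then have "R q \<noteq> {}" using rates_nonempty[OF AS AQ] by blast
  then have "value_step \<beta> V (q, a) \<in> (\<lambda>s. p s + \<mu> * q + \<beta> * cont V a (q - s)) ` R q"
    using finite_R by (auto simp: value_step_def)
  moreover have "value_step \<beta> V (q, a) \<le> p s + \<mu> * q + \<beta> * cont V a (q - s)" if "s \<in> R q" for s
    using that finite_R by (auto simp: value_step_def)
  ultimately show "(\<forall>s\<in>R q. 0 + value_step \<beta> V (q, a) \<le> p s + \<mu> * q + \<beta> * cont V a (q - s)) \<and>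
     (\<exists>s\<in>R q. 0 + value_step \<beta> V (q, a) = p s + \<mu> * q + \<beta> * cont V a (q - s))"
    by auto
qed

definition max_cost :: real where "max_cost = p S + \<mu> * Q"

lemma cost_bounds:
  assumes "q \<le> Q" "s \<le> S"
  shows "0 \<le> p s + \<mu> * q" "p s + \<mu> * q \<le> max_cost"
proof -
  show "0 \<le> p s + \<mu> * q" using assms p_nonneg[of s] \<mu>_nonneg by simp
  have "p s \<le> p S" using assms by (intro mono_onD[OF p_mono]) auto
  moreover have "\<mu> * q \<le> \<mu> * Q" using assms \<mu>_nonneg by (intro mult_left_mono) auto
  ultimately show "p s + \<mu> * q \<le> max_cost" by (simp add: max_cost_def)
qed

lemma bellman_mono:
  assumes b: "bellman v \<beta> V V'" "bellman v \<beta> W W'" and \<beta>: "0 \<le> \<beta>"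
    and le: "\<And>x. x \<in> X \<Longrightarrow> V x \<le> W x" and x: "x \<in> X"
  shows "V' x \<le> W' x"
proof -
  obtain q a where qa: "x = (q, a)" "q \<le> Q" "a \<le> A" using x by (cases x) (auto simp: X_iff)
  obtain s where s: "s \<in> R q" "v + W' (q, a) = p s + \<mu> * q + \<beta> * cont W a (q - s)"
    using bellman_attained[OF b(2) qa(2,3)] by blast
  have "\<beta> * cont V a (q - s) \<le> \<beta> * cont W a (q - s)"
    using s(1) qa AQ by (intro mult_left_mono \<beta> cont_mono le) (auto simp: X_iff R_iff)
  then show ?thesis using bellman_le[OF b(1) qa(2,3) s(1)] s(2) qa(1) by auto
qed

lemma bellman_bounds:
  assumes b: "bellman 0 \<beta> V V'" and \<beta>: "0 \<le> \<beta>"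
    and V: "\<And>x. x \<in> X \<Longrightarrow> 0 \<le> V x" "\<And>x. x \<in> X \<Longrightarrow> V x \<le> M" and x: "x \<in> X"
  shows "0 \<le> V' x" "V' x \<le> max_cost + \<beta> * M"
proof -
  obtain q a where qa: "x = (q, a)" "q \<le> Q" "a \<le> A" using x by (cases x) (auto simp: X_iff)
  obtain s where s: "s \<in> R q" "0 + V' (q, a) = p s + \<mu> * q + \<beta> * cont V a (q - s)"
    using bellman_attained[OF b qa(2,3)] by blast
  have "cont (\<lambda>_. 0) a (q - s) \<le> cont V a (q - s)" "cont V a (q - s) \<le> cont (\<lambda>_. M) a (q - s)"
    using s(1) qa AQ by (intro cont_mono V; auto simp: X_iff R_iff)+
  then have "0 \<le> \<beta> * cont V a (q - s)" "\<beta> * cont V a (q - s) \<le> \<beta> * M"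
    using qa(3) \<beta> by (auto simp: cont_const intro!: mult_left_mono)
  then show "0 \<le> V' x" "V' x \<le> max_cost + \<beta> * M"
    using cost_bounds[of q s] qa s by (auto simp: R_iff)
qed

text \<open>Value iteration from 0 increases and stays below
  \<open>max_cost / (1 - \<beta>)\<close>, the fixed point of
  \<open>M \<mapsto> max_cost + \<beta> * M\<close>, so it converges pointwise. The constant start
  is convex and monotone, and every step and the limit preserve this.\<close>

lemma discounted_fixpoint:
  assumes \<beta>: "0 \<le> \<beta>" "\<beta> < 1"
  shows "\<exists>V. bellman 0 \<beta> V V \<and> convex_mono V \<and> (\<forall>x\<in>X. 0 \<le> V x \<and> V x \<le> max_cost / (1 - \<beta>))"
proof -
  define U where "U n = (value_step \<beta> ^^ n) (\<lambda>_. 0)" for n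
  have step: "bellman 0 \<beta> (U n) (U (Suc n))" for n
    using bellman_value_step by (simp add: U_def)
  have M: "0 \<le> max_cost / (1 - \<beta>)" "max_cost + \<beta> * (max_cost / (1 - \<beta>)) = max_cost / (1 - \<beta>)"
    using cost_bounds[of 0 0] \<beta> by (auto simp: field_simps)
  have bd: "0 \<le> U n x \<and> U n x \<le> max_cost / (1 - \<beta>)" if "x \<in> X" for n x
    using that
  proof (induction n arbitrary: x)
    case 0
    then show ?case using M by (simp add: U_def)
  next
    case (Suc n)
    have "0 \<le> U (Suc n) x" "U (Suc n) x \<le> max_cost + \<beta> * (max_cost / (1 - \<beta>))"
      by (rule bellman_bounds[OF step \<beta>(1)]; use Suc in blast)+
    then show ?case unfolding M(2) by blast
  qed
  have inc: "U n x \<le> U (Suc n) x" if "x \<in> X" for n x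
    using that
  proof (induction n arbitrary: x)
    case 0
    then show ?case using bd[of x 1] by (simp add: U_def)
  next
    case (Suc n)
    then show ?case using bellman_mono[OF step step \<beta>(1)] by blast
  qed
  have conv: "(\<lambda>n. U n x) \<longlonglongrightarrow> lim (\<lambda>n. U n x)" if x: "x \<in> X" for x
  proof -
    have "incseq (\<lambda>n. U n x)" using inc[OF x] by (rule incseq_SucI)
    moreover have "\<forall>n. U n x \<le> max_cost / (1 - \<beta>)" using bd[OF x] by blast
    ultimately obtain L where "(\<lambda>n. U n x) \<longlonglongrightarrow> L" by (rule incseq_convergent)
    then show ?thesis by (simp add: limI)
  qed
  define V where "V x = lim (\<lambda>n. U n x)" for x
  have V: "(\<lambda>n. U n x) \<longlonglongrightarrow> V x" if "x \<in> X" for x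
    using conv[OF that] by (simp add: V_def)
  have shape: "convex_mono (U n)" for n
  proof (induction n)
    case 0
    then show ?case by (simp add: U_def convex_mono_def exchange_convex_def)
  next
    case (Suc n)
    then show ?case using bellman_convex_mono[OF step _ \<beta>(1)] by blast
  qed
  have "bellman 0 \<beta> V V"
    by (rule bellman_limit[OF step tendsto_const tendsto_const V LIMSEQ_Suc[OF V]])
  moreover have "convex_mono V" by (rule convex_mono_limit[OF shape V])
  moreover have "0 \<le> V x \<and> V x \<le> max_cost / (1 - \<beta>)" if "x \<in> X" for x
    using bd[OF that] by (intro conjI LIMSEQ_le_const[OF V[OF that]] LIMSEQ_le_const2[OF V[OF that]]) auto
  ultimately show ?thesis by blast
qed

end

section \<open>Reachability when the rates can be chosen freely\<close>

context controlled_queue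
begin

text \<open>The control graph, with an edge for each transition that some feasible rate makes
  possible. A single policy may be reducible, so a bound uniform in the discount factor has to use
  this larger graph.\<close>

definition steps :: "((nat \<times> nat) \<times> (nat \<times> nat)) set" where
  "steps = {((q, a), (q - s + a', a')) | q a s a'. q \<le> Q \<and> a \<le> A \<and> a' \<le> A \<and> s \<in> R q \<and> 0 < \<gamma> a a'}"

lemma stepsI:
  assumes "q \<le> Q" "a \<le> A" "a' \<le> A" "s \<in> R q" "0 < \<gamma> a a'" "q' = q - s + a'"
  shows "((q, a), (q', a')) \<in> steps"
  using assms unfolding steps_def by blast

lemma successor_exists:
  assumes "a \<le> A"
  obtains a' where "a' \<le> A" "0 < \<gamma> a a'"
proof -
  have "\<exists>a'\<in>{..A}. \<gamma> a a' > 0"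
    using \<gamma>_sum[OF assms] sum_nonpos[of "{..A}" "\<gamma> a"] by (force simp: not_less)
  then show ?thesis using that by auto
qed

text \<open>Transmitting exactly the latest arrivals freezes the residual \<open>y\<close>, while
  the arrival chain, being strongly connected, moves on to any \<open>a'\<close>.\<close>

lemma steps_keep:
  assumes "y \<le> Q - A" "a \<le> A" "a' \<le> A"
  shows "((y + a, a), (y + a', a')) \<in> steps\<^sup>*"
proof -
  have "(a, a') \<in> {(u, v). u \<in> {..A} \<and> v \<in> {..A} \<and> 0 < \<gamma> u v}\<^sup>*"
    using ergodic assms by (auto simp: ergodic_chain_def)
  then show ?thesis
  proof (induction rule: rtrancl_induct)
    case (step b c)
    then have "((y + b, b), (y + c, c)) \<in> steps"
      using assms(1) AQ AS by (intro stepsI[of _ _ _ b]) (auto simp: R_iff)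
    then show ?case using step.IH by (rule rtrancl_into_rtrancl[rotated])
  qed auto
qed

text \<open>The residual is kept until the arrivals are \<open>A\<close>; transmitting only
  \<open>A - 1\<close> then raises it by one.\<close>

lemma steps_up:
  assumes "Suc y \<le> Q - A" "a \<le> A" "a' \<le> A"
  shows "((y + a, a), (Suc y + a', a')) \<in> steps\<^sup>*"
proof -
  obtain b where b: "b \<le> A" "0 < \<gamma> A b" using successor_exists[of A] by auto
  have "((y + A, A), (Suc y + b, b)) \<in> steps"
    using assms b AQ AS A_pos by (intro stepsI[of _ _ _ "A - 1"]) (auto simp: R_iff)
  then show ?thesis
    using steps_keep[of y a A] steps_keep[of "Suc y" b a'] assms b(1)
    by (meson Suc_leD converse_rtrancl_into_rtrancl le_refl rtrancl_trans)
qed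

text \<open>The residual is kept until the arrivals are 0; transmitting one packet then lowers
  it.\<close>

lemma steps_down:
  assumes "Suc y \<le> Q - A" "a \<le> A" "a' \<le> A"
  shows "((Suc y + a, a), (y + a', a')) \<in> steps\<^sup>*"
proof -
  obtain b where b: "b \<le> A" "0 < \<gamma> 0 b" using successor_exists[of 0] by auto
  have "((Suc y + 0, 0), (y + b, b)) \<in> steps"
    using assms b AQ AS A_pos by (intro stepsI[of _ _ _ 1]) (auto simp: R_iff)
  then show ?thesis
    using steps_keep[of "Suc y" a 0] steps_keep[of y b a'] assms b(1)
    by (meson Suc_leD converse_rtrancl_into_rtrancl le0 rtrancl_trans)
qed

text \<open>After one slot every state is a residual \<open>y \<le> Q - A\<close> plus new arrivals,
  so only such targets are considered. A slot at full rate brings any state into this form; from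
  there the residual is lowered to 0 and raised to \<open>y\<close>.\<close>

lemma steps_reach:
  assumes "x \<in> X" "y \<le> Q - A" "a' \<le> A"
  shows "(x, (y + a', a')) \<in> steps\<^sup>*"
proof -
  obtain q a where x: "x = (q, a)" "q \<le> Q" "a \<le> A" using assms(1) by (cases x) (auto simp: X_iff)
  obtain b where b: "b \<le> A" "0 < \<gamma> a b" using successor_exists[OF x(3)] by auto
  define y0 where "y0 = q - min q S"
  have y0: "y0 \<le> Q - A" using rates_nonempty[OF AS AQ x(2)] by (auto simp: R_iff y0_def)
  have first: "(x, (y0 + b, b)) \<in> steps"
    unfolding x(1) using x b rates_nonempty[OF AS AQ x(2)] by (intro stepsI) (auto simp: y0_def)
  have down: "((y0 + b, b), (0 + c, c)) \<in> steps\<^sup>*" if "c \<le> A" for c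
    using y0 b(1) that
  proof (induction y0 arbitrary: b)
    case (Suc y0)
    then show ?case using steps_down[of y0 b c] by (meson Suc_leD le_refl rtrancl_trans)
  qed (use steps_keep[of 0] in auto)
  have up: "((0 + 0, 0), (y + c, c)) \<in> steps\<^sup>*" if "c \<le> A" for c
    using assms(2) that
  proof (induction y arbitrary: c)
    case (Suc y)
    then show ?case using steps_up[of y 0 c] by (meson Suc_leD le0 rtrancl_trans)
  qed (use steps_keep[of 0 0] in auto)
  show ?thesis
    using first down[of 0] up[OF assms(3)] by (meson converse_rtrancl_into_rtrancl le0 rtrancl_trans)
qed

end

section \<open>Bounds uniform in the discount factor and the vanishing discount\<close>

context queue_costs
begin

text \<open>Each step along a path divides the deficit \<open>M - V\<close> by at most a transition probability, up to
  the one-step cost; the resulting bound does not depend on the discount factor.\<close>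

lemma deficit_bound:
  assumes "(x, z) \<in> steps\<^sup>*"
  shows "\<exists>B. \<forall>\<beta> V M. 0 \<le> \<beta> \<longrightarrow> \<beta> < 1 \<longrightarrow> bellman 0 \<beta> V V \<longrightarrow> (\<forall>x\<in>X. 0 \<le> V x \<and> V x \<le> M) \<longrightarrow> V x = M
     \<longrightarrow> M - V z \<le> B"
  using assms
proof (induction rule: rtrancl_induct)
  case base
  show ?case by (auto intro!: exI[of _ 0])
next
  case (step y z)
  from step.IH obtain B where B: "\<And>\<beta> V M. 0 \<le> \<beta> \<Longrightarrow> \<beta> < 1 \<Longrightarrow> bellman 0 \<beta> V V
     \<Longrightarrow> (\<forall>x\<in>X. 0 \<le> V x \<and> V x \<le> M) \<Longrightarrow> V x = M \<Longrightarrow> M - V y \<le> B"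
    by blast
  from step.hyps(2) obtain q a s a' where y: "y = (q, a)" and z: "z = (q - s + a', a')"
    and qa: "q \<le> Q" "a \<le> A" "a' \<le> A" "s \<in> R q" and pos: "0 < \<gamma> a a'"
    unfolding steps_def by blast
  show ?case
  proof (intro exI allI impI)
    fix \<beta> M :: real and V
    assume h: "0 \<le> \<beta>" "\<beta> < 1" "bellman 0 \<beta> V V" "\<forall>x\<in>X. 0 \<le> V x \<and> V x \<le> M" "V x = M"
    have next_X: "(q - s + b, b) \<in> X" if "b \<le> A" for b
      using that qa AQ by (auto simp: X_iff R_iff)
    \<comment> \<open>All terms \<open>V x - M\<close> are nonpositive, so discarding every
      successor except \<open>z\<close> gives an upper bound.\<close>
    have "cont (\<lambda>x. V x - M) a (q - s) \<le> (\<Sum>b\<le>A. if b = a' then \<gamma> a a' * (V z - M) else 0)"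
      unfolding cont_def z using h(4) next_X qa
      by (intro sum_mono) (auto simp: \<gamma>_nonneg intro!: mult_nonneg_nonpos)
    then have "cont V a (q - s) - M \<le> \<gamma> a a' * (V z - M)"
      using qa by (simp add: cont_diff_const)
    moreover have "0 \<le> cont V a (q - s)"
      using cont_mono[OF qa(2), of "\<lambda>_. 0" "q - s" V "q - s"] next_X h(4) qa(2) by (auto simp: cont_const)
    then have "\<beta> * cont V a (q - s) \<le> cont V a (q - s)"
      using h(2) by (simp add: mult_left_le_one_le h(1))
    moreover have "0 + V y \<le> p s + \<mu> * q + \<beta> * cont V a (q - s)"
      unfolding y by (rule bellman_le[OF h(3) qa(1,2,4)])
    moreover have "p s + \<mu> * q \<le> max_cost" using qa by (intro cost_bounds) (auto simp: R_iff)
    moreover have "M - V y \<le> B" using B h by blast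
    ultimately have "\<gamma> a a' * (M - V z) \<le> B + max_cost" by (simp add: algebra_simps)
    then show "M - V z \<le> (B + max_cost) / \<gamma> a a'"
      using pos by (simp add: field_simps)
  qed
qed

text \<open>Paths from a maximum point of \<open>V\<close> bound the deficit on \<open>Z\<close>,
  the states that can follow a slot. Any other state moves into \<open>Z\<close> within one slot,
  which costs another \<open>max_cost\<close>. The Bellman inequality at the maximum point itself
  bounds \<open>(1 - \<beta>) * M\<close>.\<close>

lemma uniform_span:
  shows "\<exists>B. \<forall>\<beta> V M. 0 \<le> \<beta> \<longrightarrow> \<beta> < 1 \<longrightarrow> bellman 0 \<beta> V V \<longrightarrow> (\<forall>x\<in>X. 0 \<le> V x \<and> V x \<le> M) \<longrightarrow> M \<in> V ` X
     \<longrightarrow> (1 - \<beta>) * M \<le> max_cost \<and> (\<forall>x\<in>X. M - V x \<le> B)"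
proof -
  define Z where "Z = (\<lambda>(y, a). (y + a, a)) ` ({..Q - A} \<times> {..A})"
  have "\<forall>w\<in>X \<times> Z. \<exists>B. \<forall>\<beta> V M. 0 \<le> \<beta> \<longrightarrow> \<beta> < 1 \<longrightarrow> bellman 0 \<beta> V V
     \<longrightarrow> (\<forall>x\<in>X. 0 \<le> V x \<and> V x \<le> M) \<longrightarrow> V (fst w) = M \<longrightarrow> M - V (snd w) \<le> B"
    by (intro ballI deficit_bound) (auto simp: Z_def intro!: steps_reach)
  then obtain B where B: "\<And>w \<beta> V M. w \<in> X \<times> Z \<Longrightarrow> 0 \<le> \<beta> \<Longrightarrow> \<beta> < 1 \<Longrightarrow> bellman 0 \<beta> V V
     \<Longrightarrow> \<forall>x\<in>X. 0 \<le> V x \<and> V x \<le> M \<Longrightarrow> V (fst w) = M \<Longrightarrow> M - V (snd w) \<le> B w"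
    by metis
  define C where "C = (\<Sum>w\<in>X \<times> Z. \<bar>B w\<bar>)"
  have fin: "finite (X \<times> Z)" by (simp add: Z_def finite_X)
  have BC: "B w \<le> C" if "w \<in> X \<times> Z" for w
    using member_le_sum[of w "X \<times> Z" "\<lambda>w. \<bar>B w\<bar>"] that fin by (auto simp: C_def)
  show ?thesis
  proof (intro exI[of _ "C + max_cost"] allI impI)
    fix \<beta> M :: real and V
    assume h: "0 \<le> \<beta>" "\<beta> < 1" "bellman 0 \<beta> V V" "\<forall>x\<in>X. 0 \<le> V x \<and> V x \<le> M" "M \<in> V ` X"
    then obtain x0 where x0: "x0 \<in> X" "V x0 = M" by blast
    have "V x0 \<le> max_cost + \<beta> * M" using h x0 by (intro bellman_bounds(2)[OF h(3)]) auto
    then have M: "(1 - \<beta>) * M \<le> max_cost" using x0 by (simp add: algebra_simps)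
    have good: "M - V z \<le> C" if "z \<in> Z" for z
      using B[of "(x0, z)" \<beta> V M] BC[of "(x0, z)"] that x0 h by auto
    have "M - V x \<le> C + max_cost" if x: "x \<in> X" for x
    proof -
      obtain q a where qa: "x = (q, a)" "q \<le> Q" "a \<le> A" using x by (cases x) (auto simp: X_iff)
      obtain s where s: "s \<in> R q" "0 + V (q, a) = p s + \<mu> * q + \<beta> * cont V a (q - s)"
        using bellman_attained[OF h(3) qa(2,3)] by blast
      have "M - C \<le> V (q - s + b, b)" if "b \<le> A" for b
        using good[of "(q - s + b, b)"] s(1) that by (force simp: Z_def R_iff)
      then have "cont (\<lambda>_. M - C) a (q - s) \<le> cont V a (q - s)"
        using qa by (intro cont_mono) auto
      then have "\<beta> * (M - C) \<le> \<beta> * cont V a (q - s)"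
        using h(1) qa(3) by (intro mult_left_mono) (auto simp: cont_const)
      moreover have "\<beta> * C \<le> C"
        using h(1,2) by (intro mult_left_le_one_le) (auto simp: C_def intro!: sum_nonneg)
      moreover have "0 \<le> p s + \<mu> * q" using s(1) qa by (intro cost_bounds) (auto simp: R_iff)
      \<comment> \<open>These bounds combine to
        \<open>M - V x \<le> (1 - \<beta>) * M + \<beta> * C\<close>, where the first summand is at
        most \<open>max_cost\<close>.\<close>
      ultimately show ?thesis using s(2) qa(1) M by (simp add: algebra_simps)
    qed
    then show "(1 - \<beta>) * M \<le> max_cost \<and> (\<forall>x\<in>X. M - V x \<le> C + max_cost)" using M by blast
  qed
qed

text \<open>Vanishing discount: the fixed points for \<open>\<beta> < 1\<close>, shifted by their maximum, have a limit point
  as \<open>\<beta>\<close> tends to 1.\<close>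

theorem average_cost_optimality:
  "\<exists>v h. bellman v 1 h h \<and> convex_mono h"
proof -
  define \<beta> where "\<beta> k = 1 - inverse (real (Suc k))" for k
  have \<beta>: "0 \<le> \<beta> k" "\<beta> k < 1" for k by (auto simp: \<beta>_def field_simps)
  have \<beta>_lim: "\<beta> \<longlonglongrightarrow> 1"
    unfolding \<beta>_def using tendsto_diff[OF tendsto_const LIMSEQ_inverse_real_of_nat, of "1::real"] by simp
  obtain V where V: "\<And>k. bellman 0 (\<beta> k) (V k) (V k)" "\<And>k. convex_mono (V k)" "\<And>k x. x \<in> X \<Longrightarrow> 0 \<le> V k x"
    using discounted_fixpoint[OF \<beta>] by metis
  obtain B where B: "\<And>\<beta> V M. 0 \<le> \<beta> \<Longrightarrow> \<beta> < 1 \<Longrightarrow> bellman 0 \<beta> V V \<Longrightarrow> \<forall>x\<in>X. 0 \<le> V x \<and> V x \<le> M \<Longrightarrow> M \<in> V ` X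
     \<Longrightarrow> (1 - \<beta>) * M \<le> max_cost \<and> (\<forall>x\<in>X. M - V x \<le> B)"
    using uniform_span by blast
  define M where "M k = Max (V k ` X)" for k
  have ne: "X \<noteq> {}" by (auto simp: states_def)
  have M: "M k \<in> V k ` X" "\<And>x. x \<in> X \<Longrightarrow> V k x \<le> M k" for k
    using ne finite_X by (auto simp: M_def)
  \<comment> \<open>Subtracting \<open>M k\<close> inside the discounted continuation removes only
    \<open>\<beta> k * M k\<close>; the remainder \<open>(1 - \<beta> k) * M k\<close> plays the
    part of the average cost.\<close>
  define h where "h k x = V k x - M k" for k x
  define w where "w k = (1 - \<beta> k) * M k" for k
  have hb: "\<bar>h k x\<bar> \<le> B" if "x \<in> X" for k x
    using B[OF \<beta> V(1), of k "M k"] M(1)[of k] M(2)[of _ k] V(3)[of _ k] that by (fastforce simp: h_def)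
  have M_nonneg: "0 \<le> M k" for k using M(1)[of k] V(3)[of _ k] by auto
  have wb: "\<bar>w k\<bar> \<le> max_cost" for k
  proof -
    have "w k \<le> max_cost"
      unfolding w_def using B[OF \<beta> V(1), of k "M k"] M(1)[of k] M(2)[of _ k] V(3)[of _ k] by blast
    moreover have "0 \<le> w k" using M_nonneg[of k] \<beta>[of k] by (simp add: w_def)
    ultimately show ?thesis by simp
  qed
  have bell: "bellman (w k) (\<beta> k) (h k) (h k)" for k
  proof -
    have "(w k + h k (q, a) \<le> c + \<beta> k * cont (h k) a y) = (0 + V k (q, a) \<le> c + \<beta> k * cont (V k) a y)"
      "(w k + h k (q, a) = c + \<beta> k * cont (h k) a y) = (0 + V k (q, a) = c + \<beta> k * cont (V k) a y)"
      if "a \<le> A" for q a c y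
    proof -
      have "cont (h k) a y = cont (V k) a y - M k"
        using cont_diff_const[OF that, of "V k" "M k" y] by (simp add: h_def[abs_def])
      then have "\<beta> k * cont (h k) a y = \<beta> k * cont (V k) a y - \<beta> k * M k"
        by (simp add: right_diff_distrib)
      then show "(w k + h k (q, a) \<le> c + \<beta> k * cont (h k) a y) = (0 + V k (q, a) \<le> c + \<beta> k * cont (V k) a y)"
        "(w k + h k (q, a) = c + \<beta> k * cont (h k) a y) = (0 + V k (q, a) = c + \<beta> k * cont (V k) a y)"
        by (auto simp: h_def w_def left_diff_distrib)
    qed
    then show ?thesis using V(1)[of k] by (simp add: bellman_def)
  qed
  have shape: "convex_mono (h k)" for k
    using V(2)[of k] by (auto simp: convex_mono_def exchange_convex_def h_def algebra_simps)
  obtain l r where r: "strict_mono r" and l: "\<And>x. x \<in> X \<Longrightarrow> (\<lambda>k. h (r k) x) \<longlonglongrightarrow> l x"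
    using finite_pointwise_convergent_subsequence[OF finite_X, of h B] hb by blast
  have "\<bar>w (r k)\<bar> \<le> max_cost" for k by (rule wb)
  \<comment> \<open>A one-point index set turns the subsequence lemma into its version for a single
    real sequence.\<close>
  then obtain v s where s: "strict_mono s" and v: "(\<lambda>k. w (r (s k))) \<longlonglongrightarrow> v"
    using finite_pointwise_convergent_subsequence[of "{()}" "\<lambda>k _. w (r k)" max_cost] by auto
  have l': "(\<lambda>k. h (r (s k)) x) \<longlonglongrightarrow> l x" if "x \<in> X" for x
    using LIMSEQ_subseq_LIMSEQ[OF l[OF that] s] by (simp add: comp_def)
  have \<beta>': "(\<lambda>k. \<beta> (r (s k))) \<longlonglongrightarrow> 1"
    using LIMSEQ_subseq_LIMSEQ[OF \<beta>_lim strict_mono_o[OF r s]] by (simp add: comp_def)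
  have "bellman v 1 l l" by (rule bellman_limit[OF bell v \<beta>' l' l'])
  moreover have "convex_mono l" by (rule convex_mono_limit[OF shape l'])
  ultimately show ?thesis by blast
qed

end

subsection \<open>Pure and threshold policies\<close>

context controlled_queue
begin

definition pure :: "(nat \<Rightarrow> nat \<Rightarrow> nat) \<Rightarrow> nat \<Rightarrow> nat \<Rightarrow> nat \<Rightarrow> real" where
  "pure w q a s = of_bool (s = w q a)"

definition mean_queue :: "(nat \<times> nat \<Rightarrow> real) \<Rightarrow> real" where
  "mean_queue \<pi> = (\<Sum>x\<in>X. \<pi> x * real (fst x))"

lemma policy_pure:
  assumes "\<And>q a. q \<le> Q \<Longrightarrow> a \<le> A \<Longrightarrow> w q a \<in> R q"
  shows "policy A S Q (pure w)"
  unfolding policy_def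
proof (intro allI impI conjI)
  fix q a assume qa: "q \<le> Q" "a \<le> A"
  then have "w q a \<le> S" using assms R_iff by blast
  then show "(\<Sum>s\<le>S. pure w q a s) = 1" by (simp add: pure_def of_bool_def)
  show "pure w q a s = 0" if "s \<notin> R q" for s using that assms[OF qa] by (auto simp: pure_def)
qed (simp add: pure_def)

lemma sum_pure:
  assumes "w q a \<le> S"
  shows "(\<Sum>s\<le>S. pure w q a s * f s) = f (w q a)"
proof -
  have "(\<Sum>s\<le>S. pure w q a s * f s) = (\<Sum>s\<le>S. if s = w q a then f s else 0)"
    by (intro sum.cong) (auto simp: pure_def)
  then show ?thesis using assms by simp
qed

lemma stationary_cong:
  assumes F: "policy A S Q F" "stationary F \<pi>" and G: "policy A S Q G"
    and eq: "\<And>q a s. (q, a) \<in> X \<Longrightarrow> \<pi> (q, a) \<noteq> 0 \<Longrightarrow> s \<le> S \<Longrightarrow> F q a s = G q a s"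
  shows "stationary G \<pi>"
proof (rule stationaryI[OF G stationary_nonneg[OF F(2)] stationary_sum[OF F(2)]])
  fix f
  show "(\<Sum>x\<in>X. \<pi> x * f x) = (\<Sum>(q, a)\<in>X. \<pi> (q, a) * (\<Sum>s\<le>S. G q a s * cont f a (q - s)))"
    unfolding stationary_expectation[OF F] using eq by (intro sum.cong refl) fastforce
qed

text \<open>Instantiated with \<open>(\<le>)\<close> and \<open>(\<ge>)\<close>: a pure policy that always transmits at least (at most) as
  much as \<open>F\<close>, and whose residual queue is monotone, has stochastically shorter (longer) queues.\<close>

lemma dominated_stationary:
  fixes le :: "nat \<Rightarrow> nat \<Rightarrow> bool"
  assumes F: "policy A S Q F" "stationary F \<pi>"
    and w: "\<And>q a. q \<le> Q \<Longrightarrow> a \<le> A \<Longrightarrow> w q a \<in> R q"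
    and le_add: "\<And>y z b. le y z \<Longrightarrow> le (y + b) (z + b)"
    and residual: "\<And>q q' a. le q q' \<Longrightarrow> q \<le> Q \<Longrightarrow> q' \<le> Q \<Longrightarrow> a \<le> A \<Longrightarrow> le (q - w q a) (q' - w q' a)"
    and dom: "\<And>q a s. (q, a) \<in> X \<Longrightarrow> \<pi> (q, a) \<noteq> 0 \<Longrightarrow> F q a s \<noteq> 0 \<Longrightarrow> le (q - w q a) (q - s)"
  shows "\<exists>\<rho>. stationary (pure w) \<rho> \<and>
    (\<forall>f. (\<forall>q q' a. le q q' \<longrightarrow> q \<le> Q \<longrightarrow> q' \<le> Q \<longrightarrow> a \<le> A \<longrightarrow> f (q, a) \<le> f (q', a))
       \<longrightarrow> (\<Sum>x\<in>X. \<rho> x * f x) \<le> (\<Sum>x\<in>X. \<pi> x * f x))"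
proof -
  define \<F> where "\<F> = {f :: nat \<times> nat \<Rightarrow> real. \<forall>q q' a. le q q' \<longrightarrow> q \<le> Q \<longrightarrow> q' \<le> Q \<longrightarrow> a \<le> A \<longrightarrow> f (q, a) \<le> f (q', a)}"
  have pol: "policy A S Q (pure w)" by (rule policy_pure[OF w])
  have wS: "w q a \<le> S" if "q \<le> Q" "a \<le> A" for q a using w[OF that] R_iff by auto
  have cont_le: "cont f a y \<le> cont f a z" if "f \<in> \<F>" "le y z" "y \<le> Q - A" "z \<le> Q - A" "a \<le> A" for f a y z
  proof (rule cont_mono[OF that(5)])
    fix b assume b: "b \<le> A"
    then have "y + b \<le> Q" "z + b \<le> Q" using that AQ by auto
    then show "f (y + b, b) \<le> f (z + b, b)"
      using that(1) le_add[OF that(2), of b] b by (simp add: \<F>_def)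
  qed
  have "\<exists>\<rho>. stationary (pure w) \<rho> \<and> (\<forall>f\<in>\<F>. (\<Sum>x\<in>X. \<rho> x * f x) \<le> (\<Sum>x\<in>X. \<pi> x * f x))"
  proof (rule stationary_exists[OF pol stationary_nonneg[OF F(2)] stationary_sum[OF F(2)]])
    fix f assume f: "f \<in> \<F>"
    have K: "(\<Sum>y\<in>X. joint_kernel S \<gamma> (pure w) (q, a) y * f y) = cont f a (q - w q a)"
      if "q \<le> Q" "a \<le> A" for q a
      using kernel_expectation[OF pol that] by (simp add: sum_pure wS that)
    show "(\<lambda>x. \<Sum>y\<in>X. joint_kernel S \<gamma> (pure w) x y * f y) \<in> \<F>"
      unfolding \<F>_def mem_Collect_eq
    proof (intro allI impI)
      fix q q' a assume h: "le q q'" "q \<le> Q" "q' \<le> Q" "a \<le> A"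
      show "(\<Sum>y\<in>X. joint_kernel S \<gamma> (pure w) (q, a) y * f y) \<le> (\<Sum>y\<in>X. joint_kernel S \<gamma> (pure w) (q', a) y * f y)"
        unfolding K[OF h(2,4)] K[OF h(3,4)]
        using w[OF h(2,4)] w[OF h(3,4)] by (intro cont_le[OF f residual[OF h]] h) (auto simp: R_iff)
    qed
    have "\<pi> (q, a) * (\<Sum>s\<le>S. pure w q a s * cont f a (q - s)) \<le> \<pi> (q, a) * (\<Sum>s\<le>S. F q a s * cont f a (q - s))"
      if x: "(q, a) \<in> X" for q a
    proof (cases "\<pi> (q, a) = 0")
      case False
      have qa: "q \<le> Q" "a \<le> A" using x by (auto simp: X_iff)
      have "(\<Sum>s\<le>S. pure w q a s * cont f a (q - s)) = (\<Sum>s\<le>S. F q a s * cont f a (q - w q a))"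
        by (simp add: sum_pure[where f = "\<lambda>s. cont f a (q - s)"] wS qa policy_sum[OF F(1) qa] flip: sum_distrib_right)
      also have "\<dots> \<le> (\<Sum>s\<le>S. F q a s * cont f a (q - s))"
      proof (rule sum_mono)
        fix s
        show "F q a s * cont f a (q - w q a) \<le> F q a s * cont f a (q - s)"
        proof (cases "F q a s = 0")
          case nz: False
          then have "cont f a (q - w q a) \<le> cont f a (q - s)"
            using policy_support[OF F(1) qa nz] w[OF qa]
            by (intro cont_le[OF f dom[OF x False nz] _ _ qa(2)]) (auto simp: R_iff)
          then show ?thesis by (rule mult_left_mono) (rule policy_nonneg[OF F(1) qa])
        qed simp
      qed
      finally show ?thesis by (rule mult_left_mono) (rule stationary_nonneg[OF F(2) x])
    qed simp
    then have "(\<Sum>(q, a)\<in>X. \<pi> (q, a) * (\<Sum>s\<le>S. pure w q a s * cont f a (q - s)))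
       \<le> (\<Sum>(q, a)\<in>X. \<pi> (q, a) * (\<Sum>s\<le>S. F q a s * cont f a (q - s)))"
      by (intro sum_mono) auto
    then show "(\<Sum>(q, a)\<in>X. \<pi> (q, a) * (\<Sum>s\<le>S. pure w q a s * cont f a (q - s))) \<le> (\<Sum>x\<in>X. \<pi> x * f x)"
      unfolding stationary_expectation[OF F] .
  qed
  then show ?thesis unfolding \<F>_def by blast
qed

text \<open>The threshold for \<open>s\<close> is the largest queue length at which \<open>w\<close>
  transmits at most \<open>s\<close>, so \<open>w q a = s\<close> holds exactly between two
  consecutive thresholds. The jump condition makes \<open>q0\<close> the last queue length with its
  rate, hence a threshold, where randomisation is allowed.\<close>

lemma threshold_policyI:
  assumes w: "\<And>q a. q \<le> Q \<Longrightarrow> a \<le> A \<Longrightarrow> w q a \<in> R q"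
    and mono: "\<And>q a. q < Q \<Longrightarrow> a \<le> A \<Longrightarrow> w q a \<le> w (Suc q) a"
    and q0: "q0 \<le> Q" "a0 \<le> A" and jump: "q0 < Q \<Longrightarrow> w q0 a0 < w (Suc q0) a0"
    and H: "\<And>q a s. q \<le> Q \<Longrightarrow> a \<le> A \<Longrightarrow> (q, a) \<noteq> (q0, a0) \<Longrightarrow> H q a s = of_bool (s = w q a)"
    and H0: "\<And>s. H q0 a0 s = (1 - \<tau>) * of_bool (s = w q0 a0) + \<tau> * of_bool (s = Suc (w q0 a0))"
  shows "\<exists>thr sst ast. thresholds A S Q thr \<and> sst \<le> S \<and> ast \<le> A \<and> threshold_policy A S Q thr sst ast H"
proof -
  have w_mono: "w q a \<le> w q' a" if "q \<le> q'" "q' \<le> Q" "a \<le> A" for q q' a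
    using that
  proof (induction q' rule: dec_induct)
    case (step n)
    then show ?case using mono[of n a] by auto
  qed simp
  define L where "L s a = {q. q \<le> Q \<and> w q a \<le> s}" for s a
  define thr where "thr t a = (if t < 0 then -1 else int (Max (L (nat t) a)))" for t a
  have fin: "finite (L s a)" for s a by (rule finite_subset[of _ "{..Q}"]) (auto simp: L_def)
  \<comment> \<open>An empty queue can only transmit 0 packets, so the maximum is never taken over
    an empty set.\<close>
  have L0: "0 \<in> L s a" if "a \<le> A" for s a
    using w[of 0 a] that by (auto simp: L_def R_iff)
  have Max_L: "Max (L s a) \<in> L s a" if "a \<le> A" for s a
    using L0[OF that] fin by (intro Max_in) auto
  have le_thr: "int q \<le> thr (int s) a \<longleftrightarrow> w q a \<le> s" if qa: "q \<le> Q" "a \<le> A" for q s a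
  proof
    assume "int q \<le> thr (int s) a"
    then have "q \<le> Max (L s a)" by (simp add: thr_def)
    then show "w q a \<le> s" using Max_L[OF qa(2), of s] w_mono[of q "Max (L s a)" a] qa by (auto simp: L_def)
  next
    assume "w q a \<le> s"
    then have "q \<le> Max (L s a)" using fin qa by (intro Max_ge) (auto simp: L_def)
    then show "int q \<le> thr (int s) a" by (simp add: thr_def)
  qed
  have thr_less: "thr (int s - 1) a < int q \<longleftrightarrow> s \<le> w q a" if qa: "q \<le> Q" "a \<le> A" for q s a
  proof (cases s)
    case 0
    then show ?thesis by (simp add: thr_def)
  next
    case (Suc s')
    then show ?thesis using le_thr[OF qa, of s'] by auto
  qed
  define s0 where "s0 = w q0 a0"
  have s0: "s0 \<le> S" using w[OF q0] by (auto simp: s0_def R_iff)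
  have thr0: "thr (int s0) a0 = int q0"
  proof -
    have "Max (L s0 a0) = q0"
    proof (rule Max_eqI[OF fin])
      show "q0 \<in> L s0 a0" using q0 by (simp add: L_def s0_def)
      show "y \<le> q0" if "y \<in> L s0 a0" for y
      proof (rule ccontr)
        assume "\<not> y \<le> q0"
        then show False
          using that jump w_mono[of "Suc q0" y a0] q0 by (auto simp: L_def s0_def)
      qed
    qed
    then show ?thesis by (simp add: thr_def)
  qed
  have "thresholds A S Q thr"
    unfolding thresholds_def
  proof (intro allI impI conjI)
    fix a assume a: "a \<le> A"
    show "thr (- 1) a = - 1" "0 \<le> thr 0 a" by (simp_all add: thr_def)
    show "thr (int S) a \<le> int Q" using Max_L[OF a, of S] by (simp add: thr_def L_def)
    fix s assume "s < S"
    have "L s a \<subseteq> L (Suc s) a" by (auto simp: L_def)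
    then have "Max (L s a) \<le> Max (L (Suc s) a)"
      using L0[OF a, of s] fin by (intro Max_mono) auto
    then show "thr (int s) a \<le> thr (int s + 1) a"
      by (simp add: thr_def nat_add_distrib)
  qed
  moreover have "threshold_policy A S Q thr s0 a0 H"
    unfolding threshold_policy_def
  proof (intro allI impI conjI; (elim conjE)?)
    fix q a s assume qa: "q \<le> Q" "a \<le> A" and s: "s \<le> S"
    note thr_iff = le_thr[OF qa] thr_less[OF qa]
    have at0: "(q, a) = (q0, a0)" if "int q = thr (int s0) a" "a = a0"
      using that thr0 by simp
    {
      assume "thr (int s - 1) a < int q" "int q \<le> thr (int s) a" "a \<noteq> a0 \<or> s \<noteq> s0"
      then have "s = w q a" "(q, a) \<noteq> (q0, a0)" by (auto simp: thr_iff s0_def)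
      then show "H q a s = 1" using H[OF qa] by simp
    next
      assume h: "thr (int s - 1) a < int q" "int q < thr (int s) a" "a = a0" "s = s0"
      then have "(q, a) \<noteq> (q0, a0)" using thr0 by auto
      moreover have "s = w q a" using h thr_iff(1)[of s] thr_iff(2)[of s] by simp
      ultimately show "H q a s = 1" using H[OF qa] by simp
    next
      assume "int q = thr (int s) a" "a = a0" "s = s0"
      then have "q = q0" "a = a0" "s = w q0 a0" using thr0 by (auto simp: s0_def)
      then show "H q a s + H q a (s + 1) = 1" by (simp add: H0)
    next
      assume h: "\<not> (thr (int s - 1) a < int q \<and> int q \<le> thr (int s) a \<and> (a \<noteq> a0 \<or> s \<noteq> s0))"
        "\<not> (thr (int s - 1) a < int q \<and> int q < thr (int s) a \<and> a = a0 \<and> s = s0)"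
        "\<not> (int q = thr (int s0) a \<and> a = a0 \<and> (s = s0 \<or> s = s0 + 1))"
      show "H q a s = 0"
      proof (cases "(q, a) = (q0, a0)")
        case True
        then show ?thesis using h(3) thr0 by (auto simp: H0 s0_def)
      next
        case False
        have "s \<noteq> w q a"
        proof
          assume "s = w q a"
          then have bounds: "thr (int s - 1) a < int q" "int q \<le> thr (int s) a" by (simp_all add: thr_iff)
          then have "a = a0" "s = s0" using h(1) by auto
          then show False using h(2) bounds False thr0 by auto
        qed
        then show ?thesis using H[OF qa False] by simp
      qed
    }
  qed
  ultimately show ?thesis using s0 q0(2) by blast
qed

end

section \<open>Average cost and complementary slackness\<close>

context queue_costs
begin

definition avg_cost :: "(nat \<Rightarrow> nat \<Rightarrow> nat \<Rightarrow> real) \<Rightarrow> (nat \<times> nat \<Rightarrow> real) \<Rightarrow> real" where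
  "avg_cost F \<pi> = (\<Sum>(q, a)\<in>X. \<Sum>s\<le>S. \<pi> (q, a) * F q a s * p s) + \<mu> * mean_queue \<pi>"

text \<open>The reduced cost of rate \<open>s\<close> in state \<open>(q, a)\<close>: the amount by
  which it misses equality in the optimality equation.\<close>

definition slack :: "real \<Rightarrow> (nat \<times> nat \<Rightarrow> real) \<Rightarrow> nat \<Rightarrow> nat \<Rightarrow> nat \<Rightarrow> real" where
  "slack v h q a s = p s + \<mu> * q + cont h a (q - s) - v - h (q, a)"

text \<open>Averaging the slack over the occupation measure, stationarity cancels \<open>h\<close>
  against its expectation after one slot, and only the cost minus \<open>v\<close> remains.\<close>

lemma avg_cost_slack:
  assumes F: "policy A S Q F" "stationary F \<pi>"
  shows "avg_cost F \<pi> = v + (\<Sum>(q, a)\<in>X. \<Sum>s\<le>S. \<pi> (q, a) * F q a s * slack v h q a s)"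
proof -
  have "(\<Sum>s\<le>S. \<pi> (q, a) * F q a s * slack v h q a s)
     = (\<Sum>s\<le>S. \<pi> (q, a) * F q a s * p s) + \<mu> * (\<pi> (q, a) * q)
       + \<pi> (q, a) * (\<Sum>s\<le>S. F q a s * cont h a (q - s)) - v * \<pi> (q, a) - \<pi> (q, a) * h (q, a)"
    if "(q, a) \<in> X" for q a
  proof -
    have one: "(\<Sum>s\<le>S. F q a s) = 1" using policy_sum[OF F(1)] that by (auto simp: X_iff)
    have "(\<Sum>s\<le>S. \<pi> (q, a) * F q a s * slack v h q a s)
     = (\<Sum>s\<le>S. \<pi> (q, a) * F q a s * p s + \<pi> (q, a) * (F q a s * cont h a (q - s))
         + F q a s * (\<mu> * (\<pi> (q, a) * q) - v * \<pi> (q, a) - \<pi> (q, a) * h (q, a)))"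
      by (intro sum.cong refl) (simp add: slack_def algebra_simps)
    then show ?thesis
      by (simp add: sum.distrib one flip: sum_distrib_left sum_distrib_right)
  qed
  then have "(\<Sum>(q, a)\<in>X. \<Sum>s\<le>S. \<pi> (q, a) * F q a s * slack v h q a s)
     = (\<Sum>(q, a)\<in>X. (\<Sum>s\<le>S. \<pi> (q, a) * F q a s * p s) + \<mu> * (\<pi> (q, a) * q)
       + \<pi> (q, a) * (\<Sum>s\<le>S. F q a s * cont h a (q - s)) - v * \<pi> (q, a) - \<pi> (q, a) * h (q, a))"
    by (intro sum.cong) auto
  also have "\<dots> = (\<Sum>(q, a)\<in>X. \<Sum>s\<le>S. \<pi> (q, a) * F q a s * p s) + \<mu> * mean_queue \<pi>
       + (\<Sum>(q, a)\<in>X. \<pi> (q, a) * (\<Sum>s\<le>S. F q a s * cont h a (q - s))) - v * (\<Sum>x\<in>X. \<pi> x) - (\<Sum>x\<in>X. \<pi> x * h x)"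
    by (simp add: mean_queue_def sum.distrib sum_subtractf sum_distrib_left split_def)
  finally show ?thesis
    unfolding stationary_expectation[OF F, symmetric] stationary_sum[OF F(2)] avg_cost_def by simp
qed

context
  fixes v :: real and h :: "nat \<times> nat \<Rightarrow> real"
  assumes opt: "bellman v 1 h h" and h: "convex_mono h"
begin

abbreviation best where "best a q \<equiv> best_rates A S Q p (cont h a) q"

lemma best_subset: "best a q \<subseteq> R q"
  by (auto simp: best_rates_def)

lemma slack_nonneg: "q \<le> Q \<Longrightarrow> a \<le> A \<Longrightarrow> s \<in> R q \<Longrightarrow> 0 \<le> slack v h q a s"
  using bellman_le[OF opt, of q a s] by (simp add: slack_def)

lemma slack_zero_iff:
  assumes "q \<le> Q" "a \<le> A" "s \<in> R q"
  shows "slack v h q a s = 0 \<longleftrightarrow> s \<in> best a q"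
proof -
  obtain t where t: "t \<in> R q" "slack v h q a t = 0"
    using bellman_attained[OF opt assms(1,2)] by (auto simp: slack_def)
  show ?thesis
  proof
    assume 0: "slack v h q a s = 0"
    have "slack v h q a s \<le> slack v h q a s'" if "s' \<in> R q" for s'
      using slack_nonneg[OF assms(1,2) that] 0 by simp
    then show "s \<in> best a q" using assms(3) by (auto simp: slack_def best_rates_def)
  next
    assume "s \<in> best a q"
    then have "slack v h q a s \<le> slack v h q a t" using t(1) by (auto simp: slack_def best_rates_def)
    then show "slack v h q a s = 0" using t(2) slack_nonneg[OF assms] by simp
  qed
qed

text \<open>Complementary slackness: a sum of nonnegative terms vanishes only if each of them does,
  so cost \<open>v\<close> confines the occupation measure to optimal rates.\<close>

lemma avg_cost_ge: "policy A S Q F \<Longrightarrow> stationary F \<pi> \<Longrightarrow> v \<le> avg_cost F \<pi>"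
  and avg_cost_tight:
  "policy A S Q F \<Longrightarrow> stationary F \<pi> \<Longrightarrow> avg_cost F \<pi> \<le> v
    \<Longrightarrow> (q, a) \<in> X \<Longrightarrow> \<pi> (q, a) \<noteq> 0 \<Longrightarrow> F q a s \<noteq> 0 \<Longrightarrow> s \<in> best a q"
  and avg_cost_eq:
  "policy A S Q F \<Longrightarrow> stationary F \<pi> \<Longrightarrow> (\<And>q a s. (q, a) \<in> X \<Longrightarrow> F q a s \<noteq> 0 \<Longrightarrow> s \<in> best a q)
    \<Longrightarrow> avg_cost F \<pi> = v"
proof -
  assume F: "policy A S Q F" "stationary F \<pi>"
  let ?g = "\<lambda>q a s. \<pi> (q, a) * F q a s * slack v h q a s"
  have nn: "0 \<le> ?g q a s" if "(q, a) \<in> X" for q a s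
  proof (cases "F q a s = 0")
    case False
    then have "s \<in> R q" using that policy_support[OF F(1)] by (auto simp: X_iff)
    then show ?thesis
      using that stationary_nonneg[OF F(2) that] policy_nonneg[OF F(1)] by (auto simp: X_iff slack_nonneg)
  qed simp
  have inner_nn: "0 \<le> (\<Sum>s\<le>S. ?g q a s)" if "(q, a) \<in> X" for q a
    by (intro sum_nonneg nn[OF that])
  then have total: "0 \<le> (\<Sum>(q, a)\<in>X. \<Sum>s\<le>S. ?g q a s)"
    by (intro sum_nonneg) auto
  then show "v \<le> avg_cost F \<pi>" by (simp add: avg_cost_slack[OF F, of v h])
  show "s \<in> best a q" if "avg_cost F \<pi> \<le> v" and x: "(q, a) \<in> X" "\<pi> (q, a) \<noteq> 0" "F q a s \<noteq> 0" for q a s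
  proof -
    have qa: "q \<le> Q" "a \<le> A" using x by (auto simp: X_iff)
    have s: "s \<in> R q" by (rule policy_support[OF F(1) qa x(3)])
    have "(\<Sum>(q, a)\<in>X. \<Sum>s\<le>S. ?g q a s) = 0"
      using total that(1) by (simp add: avg_cost_slack[OF F, of v h])
    then have "\<forall>y\<in>X. (case y of (q, a) \<Rightarrow> \<Sum>s\<le>S. ?g q a s) = 0"
      using finite_X inner_nn by (subst (asm) sum_nonneg_eq_0_iff) auto
    then have "(\<Sum>s\<le>S. ?g q a s) = 0" using x(1) by auto
    then have "\<forall>s\<in>{..S}. ?g q a s = 0"
      by (subst (asm) sum_nonneg_eq_0_iff) (auto intro: nn x(1))
    then have "slack v h q a s = 0" using s x by (auto simp: R_iff)
    then show ?thesis using slack_zero_iff[OF qa s] by blast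
  qed
  show "avg_cost F \<pi> = v" if "\<And>q a s. (q, a) \<in> X \<Longrightarrow> F q a s \<noteq> 0 \<Longrightarrow> s \<in> best a q"
  proof -
    have "?g q a s = 0" if x: "(q, a) \<in> X" for q a s
    proof (cases "F q a s = 0")
      case False
      then have "s \<in> best a q" using that \<open>\<And>q a s. (q, a) \<in> X \<Longrightarrow> F q a s \<noteq> 0 \<Longrightarrow> s \<in> best a q\<close> by blast
      then have "slack v h q a s = 0" using slack_zero_iff[of q a s] best_subset x by (auto simp: X_iff)
      then show ?thesis by simp
    qed simp
    then have "(\<Sum>(q, a)\<in>X. \<Sum>s\<le>S. ?g q a s) = 0"
      by (auto intro!: sum.neutral)
    then show ?thesis by (simp add: avg_cost_slack[OF F, of v h])
  qed
qed

lemma best_facts: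
  assumes "q \<le> Q"
  shows "Max (best a q) \<in> best a q" "Min (best a q) \<in> best a q"
    and "s \<in> best a q \<Longrightarrow> s \<le> Max (best a q)" "s \<in> best a q \<Longrightarrow> Min (best a q) \<le> s"
  using best_rates_nonempty[OF AS AQ assms] finite_best_rates[OF AS AQ] by (auto intro!: Max_in Min_in)

lemma threshold_policy_same_mean_queue:
  assumes F: "policy A S Q F" "stationary F \<pi>" and cost: "avg_cost F \<pi> \<le> v"
  shows "\<exists>H \<rho>. policy A S Q H \<and> stationary H \<rho> \<and> avg_cost H \<rho> = v \<and> mean_queue \<rho> = mean_queue \<pi>
    \<and> (\<exists>thr sst ast. thresholds A S Q thr \<and> sst \<le> S \<and> ast \<le> A \<and> threshold_policy A S Q thr sst ast H)"
proof -
  note convex = p_convex cont_convex_mono(1)[OF h]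
  define u where "u q a = Max (best a q)" for q a
  define l where "l q a = Min (best a q)" for q a
  have step: "u q a \<le> u (Suc q) a" "u (Suc q) a \<le> Suc (u q a)" "l q a \<le> l (Suc q) a" "l (Suc q) a \<le> Suc (l q a)"
    if "q < Q" "a \<le> A" for q a
    using Max_best_rates_step[OF AS AQ convex(1) convex(2)[OF that(2)], of q]
      Min_best_rates_step[OF AS AQ convex(1) convex(2)[OF that(2)], of q] that by (auto simp: u_def l_def)
  have u_best: "u q a \<in> best a q" and l_best: "l q a \<in> best a q" if "q \<le> Q" for q a
    using best_facts[OF that] by (auto simp: u_def l_def)
  have u_R: "u q a \<in> R q" and l_R: "l q a \<in> R q" if "q \<le> Q" for q a
    using u_best[OF that] l_best[OF that] best_subset by blast+
  \<comment> \<open>One more packet in the queue raises the rate by at most one, so the residual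
    cannot fall. Both extreme policies need this for the comparison with \<open>F\<close>.\<close>
  have residual: "q - w q a \<le> q' - w q' a"
    if w: "\<And>q. q < Q \<Longrightarrow> w (Suc q) a \<le> Suc (w q a)" and "q \<le> q'" "q' \<le> Q"
    for w :: "nat \<Rightarrow> nat \<Rightarrow> nat" and q q' a
    using that(2,3)
  proof (induction q' rule: dec_induct)
    case (step n)
    then show ?case using w[of n] by auto
  qed simp
  have tight: "s \<in> best a q" if "(q, a) \<in> X" "\<pi> (q, a) \<noteq> 0" "F q a s \<noteq> 0" for q a s
    using avg_cost_tight[OF F cost] that .
  obtain \<rho>u where \<rho>u: "stationary (pure u) \<rho>u" "mean_queue \<rho>u \<le> mean_queue \<pi>"
  proof -
    have "\<exists>\<rho>. stationary (pure u) \<rho> \<and>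
      (\<forall>f. (\<forall>q q' a. q \<le> q' \<longrightarrow> q \<le> Q \<longrightarrow> q' \<le> Q \<longrightarrow> a \<le> A \<longrightarrow> f (q, a) \<le> f (q', a))
        \<longrightarrow> (\<Sum>x\<in>X. \<rho> x * f x) \<le> (\<Sum>x\<in>X. \<pi> x * f x))"
    proof (rule dominated_stationary[OF F, of u, OF u_R])
      show "q - u q a \<le> q' - u q' a" if "q \<le> q'" "q' \<le> Q" "a \<le> A" for q q' a
        using that by (intro residual step)
      show "q - u q a \<le> q - s" if "(q, a) \<in> X" "\<pi> (q, a) \<noteq> 0" "F q a s \<noteq> 0" for q a s
        using tight[OF that] best_facts(3)[of q s a] that(1) by (auto simp: u_def X_iff intro: diff_le_mono2)
    qed auto
    then obtain \<rho> where "stationary (pure u) \<rho>" and \<rho>: "\<And>f. (\<forall>q q' a. q \<le> q' \<longrightarrow> q \<le> Q \<longrightarrow> q' \<le> Q \<longrightarrow> a \<le> A \<longrightarrow> f (q, a) \<le> f (q', a))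
        \<Longrightarrow> (\<Sum>x\<in>X. \<rho> x * f x) \<le> (\<Sum>x\<in>X. \<pi> x * f x)" by blast
    then show ?thesis
      using that \<rho>[of "\<lambda>x. real (fst x)"] by (simp add: mean_queue_def)
  qed
  obtain \<rho>l where \<rho>l: "stationary (pure l) \<rho>l" "mean_queue \<pi> \<le> mean_queue \<rho>l"
  proof -
    have "\<exists>\<rho>. stationary (pure l) \<rho> \<and>
      (\<forall>f. (\<forall>q q' a. q \<ge> q' \<longrightarrow> q \<le> Q \<longrightarrow> q' \<le> Q \<longrightarrow> a \<le> A \<longrightarrow> f (q, a) \<le> f (q', a))
        \<longrightarrow> (\<Sum>x\<in>X. \<rho> x * f x) \<le> (\<Sum>x\<in>X. \<pi> x * f x))"
    proof (rule dominated_stationary[OF F, of l, OF l_R])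
      show "q - l q a \<ge> q' - l q' a" if "q \<ge> q'" "q \<le> Q" "a \<le> A" for q q' a
        using that by (intro residual step)
      show "q - l q a \<ge> q - s" if "(q, a) \<in> X" "\<pi> (q, a) \<noteq> 0" "F q a s \<noteq> 0" for q a s
        using tight[OF that] best_facts(4)[of q s a] that(1) by (auto simp: l_def X_iff intro: diff_le_mono2)
    qed auto
    then obtain \<rho> where "stationary (pure l) \<rho>" and \<rho>: "\<And>f. (\<forall>q q' a. q \<ge> q' \<longrightarrow> q \<le> Q \<longrightarrow> q' \<le> Q \<longrightarrow> a \<le> A \<longrightarrow> f (q, a) \<le> f (q', a))
        \<Longrightarrow> (\<Sum>x\<in>X. \<rho> x * f x) \<le> (\<Sum>x\<in>X. \<pi> x * f x)" by blast
    \<comment> \<open>For the reversed order the admissible test functions decrease in the queue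
      length, so the mean is tested through its negative.\<close>
    then show ?thesis
      using that \<rho>[of "\<lambda>x. - real (fst x)"] by (simp add: mean_queue_def sum_negf)
  qed
  \<comment> \<open>Monotonicity is part of the condition because the maximal \<open>w\<close> must
    define thresholds.\<close>
  define slow where "slow w \<longleftrightarrow> (\<forall>q\<le>Q. \<forall>a\<le>A. w q a \<in> best a q) \<and> (\<forall>q<Q. \<forall>a\<le>A. w q a \<le> w (Suc q) a)
     \<and> (\<exists>\<rho>. stationary (pure w) \<rho> \<and> mean_queue \<pi> \<le> mean_queue \<rho>)" for w
  define total where "total w = (\<Sum>(q, a)\<in>X. w q a)" for w :: "nat \<Rightarrow> nat \<Rightarrow> nat"
  have "slow l" using \<rho>l step l_best by (auto simp: slow_def)
  moreover have "total w < Suc (\<Sum>(q, a)\<in>X. S)" if "slow w" for w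
  proof -
    have "w q a \<le> S" if "(q, a) \<in> X" for q a
      using \<open>slow w\<close> that best_subset by (fastforce simp: slow_def X_iff R_iff)
    then show ?thesis unfolding total_def less_Suc_eq_le by (intro sum_mono) auto
  qed
  ultimately obtain w where "slow w" and greatest: "\<And>w'. slow w' \<Longrightarrow> total w' \<le> total w"
    using ex_has_greatest_nat[of slow l total] by blast
  have w_best: "w q a \<in> best a q" if "q \<le> Q" "a \<le> A" for q a
    using \<open>slow w\<close> that by (simp add: slow_def)
  have w_mono: "w q a \<le> w (Suc q) a" if "q < Q" "a \<le> A" for q a
    using \<open>slow w\<close> that by (simp add: slow_def)
  obtain \<rho>w where \<rho>w: "stationary (pure w) \<rho>w" "mean_queue \<pi> \<le> mean_queue \<rho>w"
    using \<open>slow w\<close> unfolding slow_def by blast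
  have w_R: "w q a \<in> R q" if "q \<le> Q" "a \<le> A" for q a using w_best[OF that] best_subset by blast
  have "\<exists>w' q0 a0 \<sigma>. q0 \<le> Q \<and> a0 \<le> A \<and> (q0 < Q \<longrightarrow> w q0 a0 < w (Suc q0) a0)
      \<and> (\<forall>q\<le>Q. \<forall>a\<le>A. w' q a \<in> best a q) \<and> (\<forall>q\<le>Q. \<forall>a\<le>A. (q, a) \<noteq> (q0, a0) \<longrightarrow> w' q a = w q a)
      \<and> (w' q0 a0 = w q0 a0 \<or> w' q0 a0 = Suc (w q0 a0))
      \<and> stationary (pure w') \<sigma> \<and> mean_queue \<sigma> \<le> mean_queue \<pi>"
  proof (cases "\<forall>q\<le>Q. \<forall>a\<le>A. w q a = u q a")
    case True
    \<comment> \<open>Here a single policy has stationary distributions on both sides of the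
      required mean, and these are mixed with \<open>w' = w\<close>. \<open>Q\<close> and
      \<open>0\<close> are placeholders: at queue length \<open>Q\<close> the jump condition is
      void.\<close>
    have "stationary (pure w) \<rho>u"
      using True by (intro stationary_cong[OF policy_pure[of u, OF u_R] \<rho>u(1) policy_pure[of w, OF w_R]])
        (auto simp: pure_def X_iff)
    then show ?thesis
      using w_best \<rho>u(2) by (intro exI[of _ w] exI[of _ Q] exI[of _ 0] exI[of _ \<rho>u]) auto
  next
    case False
    then obtain q1 a0 where q1: "q1 \<le> Q" "w q1 a0 \<noteq> u q1 a0" and a0: "a0 \<le> A" by blast
    have le_u: "w q a \<le> u q a" if "q \<le> Q" "a \<le> A" for q a
      using best_facts(3)[OF that(1) w_best[OF that]] by (simp add: u_def)
    define N where "N = {q. q \<le> Q \<and> w q a0 \<noteq> u q a0}"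
    have N: "finite N" "N \<noteq> {}"
      using q1 finite_subset[of N "{..Q}"] by (auto simp: N_def)
    define q0 where "q0 = Max N"
    have q0: "q0 \<le> Q" "w q0 a0 \<noteq> u q0 a0" using Max_in[OF N] by (auto simp: q0_def N_def)
    have after: "w q a0 = u q a0" if "q0 < q" "q \<le> Q" for q
    proof (rule ccontr)
      assume "w q a0 \<noteq> u q a0"
      then have "q \<le> q0" using that N(1) by (auto simp: q0_def N_def intro!: Max_ge)
      then show False using that by simp
    qed
    have lt: "w q0 a0 < u q0 a0" using le_u[OF q0(1) a0] q0(2) by simp
    \<comment> \<open>Above \<open>q0\<close> the rate is already the nondecreasing
      \<open>u\<close>, which exceeds \<open>w\<close> at \<open>q0\<close>. The strict jump keeps
      the raised policy monotone and puts a threshold at \<open>q0\<close>.\<close>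
    have jump: "w q0 a0 < w (Suc q0) a0" if "q0 < Q"
      using lt step(1)[OF that a0] after[of "Suc q0"] that by simp
    define w' where "w' = (\<lambda>q a. if q = q0 \<and> a = a0 then Suc (w q a) else w q a)"
    have w'_best: "w' q a \<in> best a q" if qa: "q \<le> Q" "a \<le> A" for q a
    proof (cases "q = q0 \<and> a = a0")
      case True
      then show ?thesis
        using best_rates_interval[OF AS AQ convex(1) convex(2)[OF qa(2)] w_best[OF qa] u_best[OF qa(1)], of "Suc (w q a)"] lt
        by (auto simp: w'_def)
    qed (use w_best[OF qa] in \<open>auto simp: w'_def\<close>)
    have w'_mono: "w' q a \<le> w' (Suc q) a" if "q < Q" "a \<le> A" for q a
      using w_mono[OF that] jump that by (auto simp: w'_def)
    have w'_R: "w' q a \<in> R q" if "q \<le> Q" "a \<le> A" for q a using w'_best[OF that] best_subset by blast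
    obtain \<sigma> where \<sigma>: "stationary (pure w') \<sigma>"
      using stationary_exists[OF policy_pure[of w', OF w'_R] stationary_nonneg[OF F(2)] stationary_sum[OF F(2)], of "{}"]
      by auto
    have "total w < total w'"
      unfolding total_def using q0(1) a0
      by (intro sum_strict_mono_ex1 finite_X) (auto simp: w'_def X_iff intro!: bexI[of _ "(q0, a0)"])
    then have "\<not> slow w'" using greatest[of w'] by auto
    then have "mean_queue \<sigma> \<le> mean_queue \<pi>"
      using \<sigma> w'_best w'_mono by (force simp: slow_def)
    then show ?thesis
      using q0(1) a0 jump w'_best \<sigma>
      by (intro exI[of _ w'] exI[of _ q0] exI[of _ a0] exI[of _ \<sigma>]) (auto simp: w'_def)
  qed
  then obtain w' q0 a0 \<sigma> where q0: "q0 \<le> Q" "a0 \<le> A" and jump: "q0 < Q \<longrightarrow> w q0 a0 < w (Suc q0) a0"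
    and w'_all: "\<forall>q\<le>Q. \<forall>a\<le>A. w' q a \<in> best a q" "\<forall>q\<le>Q. \<forall>a\<le>A. (q, a) \<noteq> (q0, a0) \<longrightarrow> w' q a = w q a"
    and w'_at: "w' q0 a0 = w q0 a0 \<or> w' q0 a0 = Suc (w q0 a0)"
    and \<sigma>: "stationary (pure w') \<sigma>" "mean_queue \<sigma> \<le> mean_queue \<pi>"
    by (elim exE conjE)
  have w'_best: "w' q a \<in> best a q" if "q \<le> Q" "a \<le> A" for q a
    using w'_all(1) that by simp
  have w'_eq: "w' q a = w q a" if "q \<le> Q" "a \<le> A" "(q, a) \<noteq> (q0, a0)" for q a
    using w'_all(2) that by simp
  have w'_R: "w' q a \<in> R q" if "q \<le> Q" "a \<le> A" for q a using w'_best[OF that] best_subset by blast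
  have "\<exists>t\<ge>0. t \<le> 1 \<and> (1 - t) * mean_queue \<rho>w + t * mean_queue \<sigma> = mean_queue \<pi>"
  proof (cases "mean_queue \<rho>w = mean_queue \<sigma>")
    case True
    then show ?thesis using \<rho>w(2) \<sigma>(2) by (intro exI[of _ 0]) auto
  next
    case False
    define t where "t = (mean_queue \<rho>w - mean_queue \<pi>) / (mean_queue \<rho>w - mean_queue \<sigma>)"
    have pos: "0 < mean_queue \<rho>w - mean_queue \<sigma>" using False \<rho>w(2) \<sigma>(2) by simp
    have "t * (mean_queue \<rho>w - mean_queue \<sigma>) = mean_queue \<rho>w - mean_queue \<pi>"
      using pos by (simp add: t_def)
    then have "(1 - t) * mean_queue \<rho>w + t * mean_queue \<sigma> = mean_queue \<pi>"
      by (simp add: algebra_simps)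
    moreover have "0 \<le> t" "t \<le> 1"
      using pos \<rho>w(2) \<sigma>(2) by (auto simp: t_def)
    ultimately show ?thesis by blast
  qed
  then obtain t where t: "0 \<le> t" "t \<le> 1" "(1 - t) * mean_queue \<rho>w + t * mean_queue \<sigma> = mean_queue \<pi>"
    by blast
  obtain H \<rho> where H: "policy A S Q H" "stationary H \<rho>" and \<rho>: "\<forall>x\<in>X. \<rho> x = (1 - t) * \<rho>w x + t * \<sigma> x"
    and mix: "\<forall>(q, a)\<in>X. \<exists>\<tau>. 0 \<le> \<tau> \<and> \<tau> \<le> 1 \<and> (\<forall>s. H q a s = (1 - \<tau>) * pure w q a s + \<tau> * pure w' q a s)"
    using mix_policies[OF policy_pure[of w, OF w_R] \<rho>w(1) policy_pure[of w', OF w'_R] \<sigma>(1) t(1,2)] by blast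
  have "mean_queue \<rho> = (1 - t) * mean_queue \<rho>w + t * mean_queue \<sigma>"
    using \<rho> by (simp add: mean_queue_def sum_distrib_left sum.distrib distrib_right mult.assoc)
  then have mean: "mean_queue \<rho> = mean_queue \<pi>" by (simp only: t(3))
  have cost_H: "avg_cost H \<rho> = v"
  proof (rule avg_cost_eq[OF H])
    fix q a s assume x: "(q, a) \<in> X" and nz: "H q a s \<noteq> 0"
    obtain \<tau> where "H q a s = (1 - \<tau>) * pure w q a s + \<tau> * pure w' q a s" using mix x by fast
    then have "s = w q a \<or> s = w' q a" using nz by (auto simp: pure_def)
    then show "s \<in> best a q" using w_best w'_best x by (auto simp: X_iff)
  qed
  \<comment> \<open>If \<open>w'\<close> equals \<open>w\<close> at this state, the weight is reset
    to 0, because the required form assigns the second weight to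
    \<open>Suc (w q0 a0)\<close>.\<close>
  obtain \<tau> where \<tau>: "H q0 a0 s = (1 - \<tau>) * of_bool (s = w q0 a0) + \<tau> * of_bool (s = Suc (w q0 a0))" for s
  proof -
    have "(q0, a0) \<in> X" using q0 by (simp add: X_iff)
    then obtain \<tau> where \<tau>: "\<And>s. H q0 a0 s = (1 - \<tau>) * pure w q0 a0 s + \<tau> * pure w' q0 a0 s" using mix by fast
    show ?thesis
    proof (cases "w' q0 a0 = w q0 a0")
      case True
      then show ?thesis using that[of 0] \<tau> by (auto simp: pure_def algebra_simps)
    next
      case False
      then show ?thesis using that[of \<tau>] \<tau> w'_at by (auto simp: pure_def)
    qed
  qed
  have H_eq: "H q a s = of_bool (s = w q a)" if "q \<le> Q" "a \<le> A" "(q, a) \<noteq> (q0, a0)" for q a s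
  proof -
    have "(q, a) \<in> X" using that by (simp add: X_iff)
    then obtain \<tau> where "H q a s = (1 - \<tau>) * pure w q a s + \<tau> * pure w' q a s" using mix by fast
    then show ?thesis using w'_eq[OF that] by (simp add: pure_def algebra_simps)
  qed
  show ?thesis
    by (intro exI[of _ H] exI[of _ \<rho>] conjI H cost_H mean
        threshold_policyI[of w q0 a0 H \<tau>, OF w_R w_mono q0 jump[rule_format] H_eq \<tau>])
qed

text \<open>One more packet shortens the next queue by one whatever arrives, which lowers
  \<open>h\<close> by at least \<open>\<mu> > 0\<close> at no cost in power.\<close>

lemma best_free_power:
  assumes p0: "\<And>s. p s = 0" and \<mu>: "0 < \<mu>" and qa: "q \<le> Q" "a \<le> A" and s: "s \<in> best a q"
  shows "s = min q S"
proof (rule ccontr)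
  assume ne: "s \<noteq> min q S"
  have sR: "s \<in> R q" using s best_subset by blast
  then have lt: "s < q" "s < S" using ne by (auto simp: R_iff)
  then have in_R: "Suc s \<in> R q" using sR by (auto simp: R_iff)
  have inc: "h (q - Suc s + b, b) + \<mu> \<le> h (q - s + b, b)" if "b \<le> A" for b
  proof -
    have "q - Suc s + b < Q" using that sR lt AQ by (auto simp: R_iff)
    from bellman_increment[OF opt h _ that this] show ?thesis
      using lt by (simp add: Suc_diff_Suc flip: add_Suc)
  qed
  have "cont h a (q - Suc s) \<le> cont (\<lambda>x. h x - \<mu>) a (q - s)"
    using inc by (intro cont_mono qa) (simp add: le_diff_eq)
  then have "cont h a (q - Suc s) < cont h a (q - s)"
    using \<mu> qa(2) by (simp add: cont_diff_const)
  moreover have "p s + cont h a (q - s) \<le> p (Suc s) + cont h a (q - Suc s)"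
    using s in_R by (simp add: best_rates_def)
  ultimately show False by (simp add: p0)
qed

text \<open>Optimality already forces full transmission in every state that \<open>\<pi>\<close>
  charges. Only states of mass zero are changed, so \<open>\<pi>\<close> and with it the power are
  kept.\<close>

lemma threshold_policy_free_power:
  assumes p0: "\<And>s. p s = 0" and \<mu>: "0 < \<mu>"
    and F: "policy A S Q F" "stationary F \<pi>" and cost: "avg_cost F \<pi> \<le> v"
  shows "\<exists>H. policy A S Q H \<and> stationary H \<pi> \<and> (\<forall>(q, a)\<in>X. \<pi> (q, a) \<noteq> 0 \<longrightarrow> (\<forall>s. H q a s = F q a s))
    \<and> (\<exists>thr sst ast. thresholds A S Q thr \<and> sst \<le> S \<and> ast \<le> A \<and> threshold_policy A S Q thr sst ast H)"
proof -
  define w where "w q a = min q S" for q a :: nat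
  have w_R: "w q a \<in> R q" if "q \<le> Q" for q a
    using rates_nonempty[OF AS AQ that] by (simp add: w_def)
  have eq: "F q a s = pure w q a s" if x: "(q, a) \<in> X" "\<pi> (q, a) \<noteq> 0" for q a s
  proof -
    have qa: "q \<le> Q" "a \<le> A" using x by (auto simp: X_iff)
    have off: "F q a s = 0" if "s \<noteq> w q a" for s
      using best_free_power[OF p0 \<mu> qa avg_cost_tight[OF F cost x]] that by (auto simp: w_def)
    have wS: "w q a \<in> {..S}" using w_R[OF qa(1)] by (auto simp: R_iff)
    have "(\<Sum>s\<le>S. F q a s) = (\<Sum>s\<le>S. if s = w q a then F q a (w q a) else 0)"
      using off by (intro sum.cong) auto
    then have "F q a (w q a) = 1" using policy_sum[OF F(1) qa] wS by simp
    then show ?thesis using off by (auto simp: pure_def)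
  qed
  have "policy A S Q (pure w)" by (rule policy_pure[of w, OF w_R])
  moreover from this have "stationary (pure w) \<pi>" by (rule stationary_cong[OF F]) (rule eq)
  moreover have "\<exists>thr sst ast. thresholds A S Q thr \<and> sst \<le> S \<and> ast \<le> A \<and> threshold_policy A S Q thr sst ast (pure w)"
    by (rule threshold_policyI[of w Q 0 _ 0]) (auto simp: pure_def w_R, auto simp: w_def)
  ultimately show ?thesis using eq by (intro exI[of _ "pure w"]) auto
qed

text \<open>The supporting line compares \<open>F\<close> only with achievable pairs, so
  \<open>v\<close> must be attained before minimality of \<open>F\<close> gives cost at most
  \<open>v\<close>.\<close>

lemma optimal_stationary_exists:
  assumes "policy A S Q F" "stationary F \<pi>"
  shows "\<exists>G \<sigma>. policy A S Q G \<and> stationary G \<sigma> \<and> avg_cost G \<sigma> = v"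
proof -
  define u where "u q a = Max (best a q)" for q a
  have u: "u q a \<in> best a q" if "q \<le> Q" for q a using best_facts[OF that] by (simp add: u_def)
  have u_R: "u q a \<in> R q" if "q \<le> Q" for q a using u[OF that] best_subset by blast
  obtain \<sigma> where \<sigma>: "stationary (pure u) \<sigma>"
    using stationary_exists[OF policy_pure[of u, OF u_R] stationary_nonneg[OF assms(2)] stationary_sum[OF assms(2)], of "{}"]
    by auto
  have "avg_cost (pure u) \<sigma> = v"
    using u by (intro avg_cost_eq[OF policy_pure[of u, OF u_R] \<sigma>]) (auto simp: pure_def X_iff)
  then show ?thesis using policy_pure[of u, OF u_R] \<sigma> by blast
qed

end

end

subsection \<open>The tradeoff curve\<close>

text \<open>Mean 0 would concentrate \<open>\<phi>\<close> at 0, and stationarity would then forbid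
  every transition out of 0, so that \<open>A\<close> could not be reached.\<close>

lemma mean_arrivals_pos:
  assumes "0 < A" and erg: "ergodic_chain {..A} \<gamma>" and st: "stationary_dist {..A} \<gamma> \<phi>"
  shows "0 < mean_arrivals A \<phi>"
proof (rule ccontr)
  assume "\<not> 0 < mean_arrivals A \<phi>"
  have \<phi>: "0 \<le> \<phi> a" if "a \<le> A" for a
    using st that unfolding stationary_dist_def by blast
  then have nn: "0 \<le> real a * \<phi> a" if "a \<le> A" for a using that by simp
  then have "mean_arrivals A \<phi> = 0"
    using \<open>\<not> 0 < mean_arrivals A \<phi>\<close> sum_nonneg[of "{..A}" "\<lambda>a. real a * \<phi> a"]
    by (force simp: mean_arrivals_def)
  then have "(\<Sum>a\<le>A. real a * \<phi> a) = 0" by (simp only: mean_arrivals_def)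
  then have all0: "\<forall>a\<in>{..A}. real a * \<phi> a = 0"
    by (subst (asm) sum_nonneg_eq_0_iff) (auto intro: nn)
  have zero: "\<phi> a = 0" if "a \<le> A" "a \<noteq> 0" for a
  proof -
    have "real a * \<phi> a = 0" using all0 that(1) by blast
    then show ?thesis using that(2) by simp
  qed
  have "(\<Sum>a\<le>A. \<phi> a) = (\<Sum>a\<le>A. if a = 0 then \<phi> 0 else 0)"
    using zero by (intro sum.cong) auto
  then have "\<phi> 0 = 1" using st by (simp add: stationary_dist_def)
  have stuck: "\<gamma> 0 b \<le> 0" if "b \<le> A" "b \<noteq> 0" for b
  proof -
    have K: "0 \<le> \<gamma> a b" if "a \<le> A" for a
      using erg that \<open>b \<le> A\<close> by (auto simp: ergodic_chain_def stochastic_on_def)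
    have "\<phi> 0 * \<gamma> 0 b \<le> (\<Sum>a\<le>A. \<phi> a * \<gamma> a b)"
      using \<phi> K by (intro member_le_sum) auto
    also have "\<dots> = \<phi> b" using st that by (simp add: stationary_dist_def)
    finally show ?thesis using zero[OF that] \<open>\<phi> 0 = 1\<close> by simp
  qed
  have "(0, A) \<in> {(u, v). u \<in> {..A} \<and> v \<in> {..A} \<and> 0 < \<gamma> u v}\<^sup>*"
    using erg by (simp add: ergodic_chain_def)
  then have "A = 0"
  proof (induction rule: rtrancl_induct)
    case (step y z)
    then show ?case using stuck[of z] by (auto simp: not_less)
  qed simp
  then show False using \<open>0 < A\<close> by simp
qed

lemma (in controlled_queue) avg_delay_mean_queue:
  "avg_delay A Q \<phi> \<pi> = mean_queue \<pi> / mean_arrivals A \<phi>"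
  by (simp add: avg_delay_def mean_queue_def split_def mult.commute)

lemma (in controlled_queue) convex_achievable: "convex (achievable A S Q \<gamma> \<phi> Pw)"
  unfolding convex_alt
proof (intro ballI allI impI)
  fix x y :: "real \<times> real" and t :: real
  assume x: "x \<in> achievable A S Q \<gamma> \<phi> Pw" and y: "y \<in> achievable A S Q \<gamma> \<phi> Pw" and t: "0 \<le> t \<and> t \<le> 1"
  from x obtain F \<pi> where F: "policy A S Q F" "stationary F \<pi>" and xeq: "x = (avg_power A S Q Pw F \<pi>, avg_delay A Q \<phi> \<pi>)"
    unfolding achievable_def obtains_pair_def by blast
  from y obtain G \<sigma> where G: "policy A S Q G" "stationary G \<sigma>" and yeq: "y = (avg_power A S Q Pw G \<sigma>, avg_delay A Q \<phi> \<sigma>)"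
    unfolding achievable_def obtains_pair_def by blast
  obtain H \<rho> where H: "policy A S Q H" "stationary H \<rho>" and \<rho>: "\<forall>x\<in>X. \<rho> x = (1 - t) * \<pi> x + t * \<sigma> x"
    and flow: "\<forall>(q, a)\<in>X. \<forall>s. \<rho> (q, a) * H q a s = (1 - t) * \<pi> (q, a) * F q a s + t * \<sigma> (q, a) * G q a s"
    using mix_policies[OF F G] t by blast
  have "avg_power A S Q Pw H \<rho> = (\<Sum>(q, a)\<in>X. \<Sum>s\<le>S. Pw s * ((1 - t) * \<pi> (q, a) * F q a s + t * \<sigma> (q, a) * G q a s))"
    unfolding avg_power_def using flow by (intro sum.cong refl) (auto simp: mult.assoc intro!: sum.cong)
  also have "\<dots> = (1 - t) * avg_power A S Q Pw F \<pi> + t * avg_power A S Q Pw G \<sigma>"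
    by (simp add: avg_power_def sum_distrib_left sum.distrib distrib_left split_def mult_ac)
  finally have power: "avg_power A S Q Pw H \<rho> = (1 - t) * avg_power A S Q Pw F \<pi> + t * avg_power A S Q Pw G \<sigma>" .
  have "mean_queue \<rho> = (1 - t) * mean_queue \<pi> + t * mean_queue \<sigma>"
    using \<rho> by (simp add: mean_queue_def sum_distrib_left sum.distrib distrib_right mult.assoc)
  then have "avg_delay A Q \<phi> \<rho> = (1 - t) * avg_delay A Q \<phi> \<pi> + t * avg_delay A Q \<phi> \<sigma>"
    by (simp add: avg_delay_mean_queue add_divide_distrib)
  then have "(1 - t) *\<^sub>R x + t *\<^sub>R y = (avg_power A S Q Pw H \<rho>, avg_delay A Q \<phi> \<rho>)"
    using power by (simp add: xeq yeq)
  then show "(1 - t) *\<^sub>R x + t *\<^sub>R y \<in> achievable A S Q \<gamma> \<phi> Pw"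
    using H unfolding achievable_def obtains_pair_def by blast
qed

theorem theorem6:
  fixes A S Q :: nat
    and \<gamma> :: "nat \<Rightarrow> nat \<Rightarrow> real"
    and \<phi> Pw :: "nat \<Rightarrow> real"
    and Pst Dst :: real
  assumes "0 < A" and "0 < S" and "0 < Q" and "A \<le> S" and "A \<le> Q"
    and "ergodic_chain {..A} \<gamma>"
    and "stationary_dist {..A} \<gamma> \<phi>"
    and "Pw 0 = 0" and "mono_on {..S} Pw" and "convex_power S Pw"
    and "(Pst, Dst) \<in> tradeoff_curve A S Q \<gamma> \<phi> Pw"
  shows "\<exists>F. policy A S Q F \<and> obtains_pair A S Q \<gamma> \<phi> Pw F (Pst, Dst) \<and>
           (\<exists>thr sst ast. thresholds A S Q thr \<and> sst \<le> S \<and> ast \<le> A \<and>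
              threshold_policy A S Q thr sst ast F)"
proof -
  interpret controlled_queue A S Q \<gamma> by unfold_locales (use assms in auto)
  define \<alpha> where "\<alpha> = mean_arrivals A \<phi>"
  have \<alpha>: "0 < \<alpha>" unfolding \<alpha>_def using mean_arrivals_pos assms by blast
  have ach: "(Pst, Dst) \<in> achievable A S Q \<gamma> \<phi> Pw"
    and pareto: "\<And>P D. (P, D) \<in> achievable A S Q \<gamma> \<phi> Pw \<Longrightarrow> Pst \<le> P \<or> Dst \<le> D"
    using assms(11) unfolding tradeoff_curve_def by auto
  obtain F \<pi> where F: "policy A S Q F" "stationary F \<pi>"
    and Pst: "Pst = avg_power A S Q Pw F \<pi>" and Dst: "Dst = avg_delay A Q \<phi> \<pi>"
    using ach unfolding achievable_def obtains_pair_def by blast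
  obtain k l where kl: "0 \<le> k" "0 \<le> l" "(k, l) \<noteq> (0, 0)"
    and support: "\<forall>(P, D)\<in>achievable A S Q \<gamma> \<phi> Pw. k * Pst + l * Dst \<le> k * P + l * D"
    using weak_pareto_supporting_line[OF convex_achievable ach pareto] by blast
  \<comment> \<open>By this choice of weights \<open>k * P + l * D\<close> is the average cost;
    dividing by the mean arrivals turns the weight on delay into one on queue length.\<close>
  interpret queue_costs A S Q \<gamma> "\<lambda>s. k * Pw s" "l / \<alpha>"
  proof unfold_locales
    show "exchange_convex S (\<lambda>s. k * Pw s)"
      by (intro exchange_convex_scale convex_power_imp_exchange_convex assms kl)
    show "mono_on {..S} (\<lambda>s. k * Pw s)"
      using assms(9) kl(1) by (auto intro!: mono_onI mult_left_mono dest: mono_onD)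
    show "0 \<le> k * Pw s" if "s \<le> S" for s
      using mono_onD[OF assms(9), of 0 s] that assms(8) kl(1) by simp
    show "0 \<le> l / \<alpha>" using kl(2) \<alpha> by simp
  qed
  have delay: "avg_delay A Q \<phi> \<sigma> = mean_queue \<sigma> / \<alpha>" for \<sigma>
    by (simp add: avg_delay_mean_queue \<alpha>_def)
  have cost: "avg_cost G \<sigma> = k * avg_power A S Q Pw G \<sigma> + l * avg_delay A Q \<phi> \<sigma>" for G \<sigma>
    by (simp add: avg_cost_def avg_power_def delay sum_distrib_left split_def mult_ac)
  obtain v h where opt: "bellman v 1 h h" "convex_mono h" using average_cost_optimality by blast
  obtain G \<sigma> where G: "policy A S Q G" "stationary G \<sigma>" "avg_cost G \<sigma> = v"
    using optimal_stationary_exists[OF opt F] by blast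
  have "(avg_power A S Q Pw G \<sigma>, avg_delay A Q \<phi> \<sigma>) \<in> achievable A S Q \<gamma> \<phi> Pw"
    using G unfolding achievable_def obtains_pair_def by blast
  then have "avg_cost F \<pi> \<le> avg_cost G \<sigma>"
    using support unfolding cost Pst Dst by blast
  then have le: "avg_cost F \<pi> \<le> v" using G(3) by simp
  show ?thesis
  proof (cases "k = 0")
    case True
    then have "0 < l / \<alpha>" using kl \<alpha> by auto
    then obtain H where H: "policy A S Q H" "stationary H \<pi>"
      and eq: "\<forall>(q, a)\<in>X. \<pi> (q, a) \<noteq> 0 \<longrightarrow> (\<forall>s. H q a s = F q a s)"
      and thr: "\<exists>thr sst ast. thresholds A S Q thr \<and> sst \<le> S \<and> ast \<le> A \<and> threshold_policy A S Q thr sst ast H"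
      using threshold_policy_free_power[OF opt _ _ F le] True by auto
    have "avg_power A S Q Pw H \<pi> = Pst"
      unfolding Pst avg_power_def using eq by (intro sum.cong refl) (fastforce intro!: sum.cong)
    then have "obtains_pair A S Q \<gamma> \<phi> Pw H (Pst, Dst)"
      using H(2) Dst unfolding obtains_pair_def by blast
    then show ?thesis using H(1) thr by blast
  next
    case False
    obtain H \<rho> where H: "policy A S Q H" "stationary H \<rho>" "avg_cost H \<rho> = v" "mean_queue \<rho> = mean_queue \<pi>"
      and thr: "\<exists>thr sst ast. thresholds A S Q thr \<and> sst \<le> S \<and> ast \<le> A \<and> threshold_policy A S Q thr sst ast H"
      using threshold_policy_same_mean_queue[OF opt F le] by blast
    have same_delay: "avg_delay A Q \<phi> \<rho> = Dst" by (simp add: Dst delay H(4))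
    \<comment> \<open>Equal cost and equal delay leave equal multiples of the power, and
      \<open>k\<close> can be cancelled.\<close>
    have "avg_cost H \<rho> = avg_cost F \<pi>" using le avg_cost_ge[OF opt F] H(3) by simp
    then have "k * avg_power A S Q Pw H \<rho> = k * Pst"
      by (simp only: cost same_delay Pst Dst add_right_cancel)
    then have "avg_power A S Q Pw H \<rho> = Pst"
      using False by simp
    then have "obtains_pair A S Q \<gamma> \<phi> Pw H (Pst, Dst)"
      using H(2) same_delay unfolding obtains_pair_def by blast
    then show ?thesis using H(1) thr by blast
  qed
qed

end
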